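(* Let $\mathcal{A}=\bigcup_{i=1}^d V(\alpha_i)\subseteq \mathbb{P}^2$ be an arrangement of $d\ge 1$ distinct lines, let $X$ be the blowup of $\mathbb{P}^2$ at the points of $L_2(\mathcal{A})$, and let $\phi_{\mathcal{A}}\colon X\to \mathbb{P}(H^0(D_{\mathcal{A}})^\vee)$ be the map defined by the complete linear system of $D_{\mathcal{A}}$. Then the Orlik–Terao algebra $C(\mathcal{A})$ is the homogeneous coordinate ring of $\phi_{\mathcal{A}}(X)$. (Here $H^0(D_{\mathcal{A}})$ has basis $l_1,\dots,l_d$, and $y_i$ is the homogeneous coordinate on $\mathbb{P}(H^0(D_{\mathcal{A}})^\vee)\cong\mathbb{P}^{d-1}$ corresponding to $l_i$.)
   Context: All varieties are over $\mathbb{C}$. $\alpha_1,\dots,\alpha_d\in S=\mathbb{C}[x,y,z]$ are pairwise non-proportional nonzero linear forms, $\alpha=\prod_{i=1}^d\alpha_i$, and $l_i=\alpha/\alpha_i$. $L_2(\mathcal{A})$ is the set of points of $\mathbb{P}^2$ lying on at least two of the lines; for $p\in L_2(\mathcal{A})$, $\mu(p)$ is one less than the number of lines of $\mathcal{A}$ through $p$. On the blowup $X\to\mathbb{P}^2$ at $L_2(\mathcal{A})=\{p_1,\dots,p_n\}$, $E_0$ is the class of the pullback of a line and $E_i$ is the exceptional curve over $p_i$; put $D_{\mathcal{A}}=(d-1)E_0-\sum_{p_i\in L_2(\mathcal{A})}\mu(p_i)E_i$. For $m,a_i\ge 0$, $H^0(mE_0-\sum a_iE_i)$ is identified with the degree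 $m$ part of $\bigcap_i I_{p_i}^{a_i}\subseteq S$, where $I_{p_i}$ is the ideal of $p_i$. Orlik–Terao algebra: let $R=\mathbb{C}[y_1,\dots,y_d]$. For each linear dependency $\Lambda:\ \sum_{j=1}^k c_{i_j}\alpha_{i_j}=0$ put $f_\Lambda=\sum_{j=1}^k c_{i_j}\,(y_{i_1}\cdots\widehat{y_{i_j}}\cdots y_{i_k})$, and let $I$ be the ideal generated by all the $f_\Lambda$. Then $C(\mathcal{A})=R/I$. *)

theory Defs
  imports
    "HOL-Analysis.Analysis"
    "HOL-Algebra.QuotRing"
    "HOL-Algebra.Ideal_Product"
    "HOL-Algebra.Algebraic_Closure_Type"
    "HOL-Library.Poly_Mapping"
    "HOL-Library.Function_Algebras"
    "HOL-Library.FuncSet"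
    "HOL-Library.Numeral_Type"
begin

section \<open>Polynomials\<close>

text \<open>Polynomials over the complex numbers in variables indexed by a finite type: finitely
  supported functions from exponent vectors to coefficients, with the convolution product of
  \<open>Poly_Mapping\<close>. Thus \<open>3 mpoly\<close> is \<open>S\<close>, and \<open>'n mpoly\<close> is \<open>R\<close>, where \<open>d = CARD('n)\<close>.\<close>

type_synonym 'x mpoly = "('x \<Rightarrow>\<^sub>0 nat) \<Rightarrow>\<^sub>0 complex"

abbreviation poly_ring :: "'x mpoly ring" where
  "poly_ring \<equiv> ring_of_type_algebra"

definition Const :: "complex \<Rightarrow> 'x mpoly" where
  "Const c = Poly_Mapping.single 0 c"

definition Var :: "'x \<Rightarrow> 'x mpoly" where
  "Var i = Poly_Mapping.single (Poly_Mapping.single i 1) 1"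

definition pscale :: "complex \<Rightarrow> 'x mpoly \<Rightarrow> 'x mpoly" where
  "pscale c f = Const c * f"

definition homogeneous :: "nat \<Rightarrow> 'x::finite mpoly \<Rightarrow> bool" where
  "homogeneous m f \<longleftrightarrow>
    (\<forall>t\<in>Poly_Mapping.keys f. (\<Sum>i\<in>UNIV. Poly_Mapping.lookup t i) = m)"

text \<open>Substitution of elements \<open>h i\<close> of a commutative ring for the variables, the coefficients
  being mapped by \<open>emb\<close>.\<close>

definition msubst ::
    "(complex \<Rightarrow> 'r::comm_ring_1) \<Rightarrow> ('x::finite \<Rightarrow> 'r) \<Rightarrow> 'x mpoly \<Rightarrow> 'r" where
  "msubst emb h f = (\<Sum>t\<in>Poly_Mapping.keys f.
      emb (Poly_Mapping.lookup f t) * (\<Prod>i\<in>UNIV. h i ^ Poly_Mapping.lookup t i))"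

definition meval :: "complex ^ 'x \<Rightarrow> 'x::finite mpoly \<Rightarrow> complex" where
  "meval u f = msubst (\<lambda>c. c) (\<lambda>i. u $ i) f"

text \<open>The univariate polynomial \<open>f(u + t v)\<close> in \<open>t\<close>.\<close>

definition along :: "complex ^ 'x \<Rightarrow> complex ^ 'x \<Rightarrow> 'x::finite mpoly \<Rightarrow> complex poly" where
  "along u v f = msubst (\<lambda>c. [:c:]) (\<lambda>i. [:u $ i, v $ i:]) f"


section \<open>Projective spaces and homogeneous ideals\<close>

text \<open>\<open>\<P>(V)\<close> as the set of one-dimensional linear subspaces of \<open>V\<close>.\<close>

definition projectivization ::
    "('c::field \<Rightarrow> 'v::ab_group_add \<Rightarrow> 'v) \<Rightarrow> 'v set \<Rightarrow> 'v set set" where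
  "projectivization sc V = (\<lambda>v. module.span sc {v}) ` (V - {0})"

type_synonym point = "(complex ^ 3) set"

definition P2 :: "point set" where
  "P2 = projectivization (*s) UNIV"

text \<open>Lines in \<open>\<P>\<^sup>2\<close>; a point \<open>p\<close> lies on a line \<open>L\<close> iff \<open>p \<subseteq> L\<close>.\<close>

definition lines_P2 :: "(complex ^ 3) set set" where
  "lines_P2 = {L. vec.subspace L \<and> vec.dim L = 2}"

definition vanishes_at :: "'x::finite mpoly \<Rightarrow> (complex ^ 'x) set \<Rightarrow> bool" where
  "vanishes_at f p \<longleftrightarrow> (\<forall>u\<in>p. meval u f = 0)"

definition vanishing_ideal :: "(complex ^ 'x) set set \<Rightarrow> 'x::finite mpoly set" where
  "vanishing_ideal Y =
    Idl\<^bsub>poly_ring\<^esub> {f. (\<exists>m. homogeneous m f) \<and> (\<forall>p\<in>Y. vanishes_at f p)}"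

definition homogeneous_coordinate_ring ::
    "(complex ^ 'x) set set \<Rightarrow> ('x::finite mpoly set) ring" where
  "homogeneous_coordinate_ring Y = poly_ring Quot vanishing_ideal Y"

primrec ideal_power :: "('a, 'b) ring_scheme \<Rightarrow> 'a set \<Rightarrow> nat \<Rightarrow> 'a set" where
  "ideal_power A I 0 = carrier A"
| "ideal_power A I (Suc k) = ideal_prod A I (ideal_power A I k)"


section \<open>Blowups of the plane at finitely many points, and linear systems on them\<close>

text \<open>The blowup of \<open>\<P>\<^sup>2\<close> at one point \<open>p\<close> is the set of pairs \<open>(q, L)\<close> with \<open>L\<close> a line
  through \<open>p\<close> and \<open>q\<close>, and the blowup at a finite set \<open>Z\<close> of points is the fibre product over
  \<open>\<P>\<^sup>2\<close> of the blowups at the points of \<open>Z\<close>. The exceptional curve over \<open>p \<in> Z\<close> consists of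
  the \<open>(q, L)\<close> with \<open>q = p\<close>; its coordinate is the line \<open>L p\<close>.\<close>

definition blowup :: "point set \<Rightarrow> (point \<times> (point \<Rightarrow> (complex ^ 3) set)) set" where
  "blowup Z = {(q, L). q \<in> P2 \<and> L \<in> Z \<rightarrow>\<^sub>E lines_P2 \<and> (\<forall>p\<in>Z. p \<subseteq> L p \<and> q \<subseteq> L p)}"

text \<open>A pair \<open>(m, a)\<close> stands for the class \<open>m E\<^sub>0 - \<Sum> a(p) E\<^sub>p\<close> on the blowup at \<open>Z\<close>.\<close>

type_synonym divisor_class = "nat \<times> (point \<Rightarrow> nat)"

definition H0 :: "point set \<Rightarrow> divisor_class \<Rightarrow> 3 mpoly set" where
  "H0 Z D = {f. homogeneous (fst D) f}
     \<inter> (\<Inter>p\<in>Z. ideal_power poly_ring (vanishing_ideal {p}) (snd D p))"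

text \<open>Linear functionals on a subspace \<open>V\<close> of \<open>S\<close>, extended by \<open>0\<close> outside \<open>V\<close>.\<close>

definition fscale :: "complex \<Rightarrow> ('a \<Rightarrow> complex) \<Rightarrow> ('a \<Rightarrow> complex)" where
  "fscale c \<psi> = (\<lambda>f. c * \<psi> f)"

definition dual_space :: "'x mpoly set \<Rightarrow> ('x mpoly \<Rightarrow> complex) set" where
  "dual_space V = {\<psi>. (\<forall>f. f \<notin> V \<longrightarrow> \<psi> f = 0) \<and>
     (\<forall>f\<in>V. \<forall>g\<in>V. \<psi> (f + g) = \<psi> f + \<psi> g) \<and> (\<forall>c. \<forall>f\<in>V. \<psi> (pscale c f) = c * \<psi> f)}"

text \<open>The values at \<open>x = (q, L)\<close> of the sections of \<open>\<O>(D)\<close>, for the various identifications of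
  the fibre of \<open>\<O>(D)\<close> at \<open>x\<close> with the complex numbers. The section given by \<open>f\<close> is the pullback
  of \<open>f\<close> divided by \<open>\<Prod> e\<^sub>p ^ a(p)\<close>, with \<open>e\<^sub>p\<close> a local equation of the exceptional curve over
  \<open>p\<close>. Off the exceptional curves its value is \<open>f(u)\<close>, \<open>u\<close> a homogeneous coordinate vector of
  \<open>q\<close>. If \<open>q = p \<in> Z\<close>, let \<open>v\<close> be such that \<open>u\<close> and \<open>v\<close> span \<open>L p\<close>: the curve \<open>t \<mapsto> u + t v\<close>
  lifts to a curve through \<open>x\<close> along which \<open>e\<^sub>p\<close> is \<open>t\<close> times a unit, so the value is the
  coefficient of \<open>t ^ a(p)\<close> in \<open>f(u + t v)\<close>.\<close>

definition section_values ::
    "point set \<Rightarrow> divisor_class \<Rightarrow> point \<times> (point \<Rightarrow> (complex ^ 3) set) \<Rightarrow>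
      (3 mpoly \<Rightarrow> complex) set" where
  "section_values Z D x = (case x of (q, L) \<Rightarrow>
     if q \<in> Z then
       {\<lambda>f. if f \<in> H0 Z D then Polynomial.coeff (along u v f) (snd D q) else 0 | u v.
          u \<in> q - {0} \<and> v \<in> L q - q}
     else {\<lambda>f. if f \<in> H0 Z D then meval u f else 0 | u. u \<in> q - {0}})"

text \<open>The map given by the complete linear system of \<open>D\<close>: it sends \<open>x\<close> to the line in the dual
  of \<open>H\<^sup>0(D)\<close> spanned by evaluation of sections at \<open>x\<close>. It takes values in
  \<open>projectivization fscale (dual_space (H0 Z D))\<close> exactly where \<open>D\<close> has no base points.\<close>

definition linear_system_map ::
    "point set \<Rightarrow> divisor_class \<Rightarrow> point \<times> (point \<Rightarrow> (complex ^ 3) set) \<Rightarrow>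
      (3 mpoly \<Rightarrow> complex) set" where
  "linear_system_map Z D x = module.span fscale (section_values Z D x)"

definition is_basis :: "('n \<Rightarrow> 'x mpoly) \<Rightarrow> 'x mpoly set \<Rightarrow> bool" where
  "is_basis b V \<longleftrightarrow>
     inj b \<and> \<not> module.dependent pscale (range b) \<and> module.span pscale (range b) = V"

text \<open>The identification of the projectivized dual with the space of homogeneous coordinate
  vectors: the \<open>i\<close>-th coordinate of \<open>\<psi>\<close> is \<open>\<psi> (b i)\<close>.\<close>

definition dual_coords ::
    "('n::finite \<Rightarrow> 'x mpoly) \<Rightarrow> ('x mpoly \<Rightarrow> complex) set \<Rightarrow> (complex ^ 'n) set" where
  "dual_coords b W = (\<lambda>\<psi>. \<chi> i. \<psi> (b i)) ` W"

text \<open>The scalar multiplications above do form complex vector spaces, so that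
  \<^const>\<open>module.span\<close> and \<^const>\<open>module.dependent\<close> have their usual meaning.\<close>

lemma vector_space_pscale: "vector_space (pscale :: complex \<Rightarrow> 'x mpoly \<Rightarrow> 'x mpoly)"
proof -
  have 1: "Const 1 = (1 :: 'x mpoly)"
    by (simp add: Const_def)
  have 2: "Const (a + b) = (Const a + Const b :: 'x mpoly)" for a b
    by (simp add: Const_def single_add)
  have 3: "Const (a * b) = (Const a * Const b :: 'x mpoly)" for a b
    by (simp add: Const_def mult_single)
  show ?thesis
    by unfold_locales (simp_all add: pscale_def 1 2 3 algebra_simps)
qed

lemma vector_space_fscale: "vector_space (fscale :: complex \<Rightarrow> ('a \<Rightarrow> complex) \<Rightarrow> _)"
  by unfold_locales (simp_all add: fscale_def fun_eq_iff algebra_simps)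


section \<open>Line arrangements\<close>

definition line_arrangement :: "('n::finite \<Rightarrow> 3 mpoly) \<Rightarrow> bool" where
  "line_arrangement \<alpha> \<longleftrightarrow> (\<forall>i. homogeneous 1 (\<alpha> i) \<and> \<alpha> i \<noteq> 0) \<and>
     (\<forall>i j. i \<noteq> j \<longrightarrow> \<not> (\<exists>c. \<alpha> i = pscale c (\<alpha> j)))"

definition lines_through :: "('n::finite \<Rightarrow> 3 mpoly) \<Rightarrow> point \<Rightarrow> 'n set" where
  "lines_through \<alpha> p = {i. vanishes_at (\<alpha> i) p}"

definition L2 :: "('n::finite \<Rightarrow> 3 mpoly) \<Rightarrow> point set" where
  "L2 \<alpha> = {p \<in> P2. card (lines_through \<alpha> p) \<ge> 2}"

definition mu :: "('n::finite \<Rightarrow> 3 mpoly) \<Rightarrow> point \<Rightarrow> nat" where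
  "mu \<alpha> p = card (lines_through \<alpha> p) - 1"

definition D_arr :: "('n::finite \<Rightarrow> 3 mpoly) \<Rightarrow> divisor_class" where
  "D_arr \<alpha> = (CARD('n) - 1, mu \<alpha>)"

text \<open>\<open>l\<^sub>i = \<alpha> / \<alpha>\<^sub>i\<close>, where \<open>\<alpha>\<close> is the product of all the linear forms.\<close>

definition l_form :: "('n::finite \<Rightarrow> 3 mpoly) \<Rightarrow> 'n \<Rightarrow> 3 mpoly" where
  "l_form \<alpha> i = (\<Prod>j\<in>UNIV - {i}. \<alpha> j)"

definition phi_arr ::
    "('n::finite \<Rightarrow> 3 mpoly) \<Rightarrow> point \<times> (point \<Rightarrow> (complex ^ 3) set) \<Rightarrow>
      (3 mpoly \<Rightarrow> complex) set" where
  "phi_arr \<alpha> = linear_system_map (L2 \<alpha>) (D_arr \<alpha>)"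


section \<open>The Orlik-Terao algebra\<close>

text \<open>A dependency is given by the set \<open>J = {i\<^sub>1, \<dots>, i\<^sub>k}\<close> of indices involved and
  coefficients \<open>c\<close> (of which only those on \<open>J\<close> matter).\<close>

definition dependency :: "('n::finite \<Rightarrow> 3 mpoly) \<Rightarrow> 'n set \<Rightarrow> ('n \<Rightarrow> complex) \<Rightarrow> bool" where
  "dependency \<alpha> J c \<longleftrightarrow> (\<Sum>j\<in>J. pscale (c j) (\<alpha> j)) = 0"

definition OT_relation :: "'n::finite set \<Rightarrow> ('n \<Rightarrow> complex) \<Rightarrow> 'n mpoly" where
  "OT_relation J c = (\<Sum>j\<in>J. pscale (c j) (\<Prod>i\<in>J - {j}. Var i))"

definition OT_ideal :: "('n::finite \<Rightarrow> 3 mpoly) \<Rightarrow> 'n mpoly set" where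
  "OT_ideal \<alpha> = Idl\<^bsub>poly_ring\<^esub> {OT_relation J c | J c. dependency \<alpha> J c}"

definition OT_algebra :: "('n::finite \<Rightarrow> 3 mpoly) \<Rightarrow> ('n mpoly set) ring" where
  "OT_algebra \<alpha> = poly_ring Quot OT_ideal \<alpha>"

end

theory Submission
  imports Defs
begin

text \<open>Write \<open>\<alpha>\<^sub>i\<close> also for the linear form as a function, and let \<open>l\<^sub>i = \<alpha> / \<alpha>\<^sub>i\<close>. Where \<open>\<alpha>\<close> does not vanish, the
  vector of the \<open>l\<^sub>i(u)\<close> is \<open>\<alpha>(u)\<close> times the vector of the reciprocals \<open>1 / \<alpha>\<^sub>i(u)\<close>. So, once the
  \<open>l\<^sub>i\<close> are known to be a basis of the sections, the homogeneous polynomials that vanish on the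
  image of \<open>\<phi>\<close> over the complement of the lines are those that vanish at all vectors of
  reciprocals. The theorem says that these polynomials generate the Orlik-Terao ideal.

  The \<open>l\<^sub>i\<close> form a basis. Each \<open>l\<^sub>i\<close> is a section because at least \<open>\<mu>(p)\<close> of its factors vanish at
  \<open>p\<close>. On the line \<open>\<alpha>\<^sub>i = 0\<close> every \<open>l\<^sub>j\<close> with \<open>j \<noteq> i\<close> vanishes and \<open>l\<^sub>i\<close> does not, so the \<open>l\<^sub>i\<close> are independent.
  A section \<open>f\<close>, restricted to that line, vanishes at every \<open>p\<close> to order at least \<open>\<mu>(p)\<close>. These
  orders are those of \<open>l\<^sub>i\<close> and add up to the common degree \<open>d - 1\<close>, so \<open>f\<close> is a multiple \<open>c\<^sub>i l\<^sub>i\<close> there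
  (\<open>section_on_line\<close>). Then \<open>f - \<Sum> c\<^sub>i l\<^sub>i\<close> has degree \<open>d - 1\<close> and vanishes on all \<open>d\<close> lines, so it
  is \<open>0\<close> (\<open>vanishing_on_lines_imp_0\<close>).

  There are no base points. The values of the \<open>l\<^sub>i\<close> at a point of the blowup are explicit products,
  also on the exceptional curves (\<open>coeff_along_l_form\<close>): they depend on the choice of coordinates
  only by a common factor, and one of them is not \<open>0\<close>.

  The Orlik-Terao relations vanish on the image: they vanish at vectors of reciprocals, and every
  point of the image is a limit of multiples of such vectors along a curve leaving all the lines
  (\<open>OT_relation_vanishes_at_limit\<close>).

  Conversely, a polynomial \<open>F\<close> that vanishes at all vectors of reciprocals lies in the Orlik-Terao
  ideal (\<open>vanishing_at_reciprocals_imp_OT_on\<close>). This is proved by deletion and restriction, by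
  induction on the number of forms, for nonzero but possibly proportional forms on any vector space
  \<open>V\<close>. Let \<open>\<alpha>\<^sub>n\<close> be one of the forms and write \<open>F = \<Sum> G\<^sub>m y\<^sub>n ^ m\<close>, the sum over \<open>m \<le> M\<close>, where the
  \<open>G\<^sub>m\<close> do not involve \<open>y\<^sub>n\<close>. If \<open>M > 0\<close>, the pole of order \<open>M\<close> along \<open>\<alpha>\<^sub>n = 0\<close> must cancel, so \<open>G\<^sub>M\<close>
  vanishes at the reciprocals of the forms restricted to \<open>\<alpha>\<^sub>n = 0\<close> and is, by induction, in the ideal
  of the restricted forms. A dependency between restricted forms is a dependency between the
  \<open>\<alpha>\<^sub>j\<close> and \<open>\<alpha>\<^sub>n\<close>, and its relation shows that \<open>y\<^sub>n G\<^sub>M\<close> is congruent to a polynomial without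
  \<open>y\<^sub>n\<close>. This lowers \<open>M\<close>, until \<open>F\<close> does not involve \<open>y\<^sub>n\<close> and \<open>\<alpha>\<^sub>n\<close> can be deleted.\<close>

section \<open>Evaluation of polynomials\<close>

lemma mpoly_induct [case_names monomial add]:
  fixes f :: "'x mpoly"
  assumes "\<And>t c. P (Poly_Mapping.single t c)" and "\<And>f g. P f \<Longrightarrow> P g \<Longrightarrow> P (f + g)"
  shows "P f"
proof -
  have "P (\<Sum>t\<in>K. Poly_Mapping.single t (Poly_Mapping.lookup f t))" if "finite K" for K
    using that
  proof induction
    case empty
    show ?case using assms(1)[of 0 0] by simp
  next
    case (insert t K)
    then show ?case using assms by simp
  qed
  moreover have "f = (\<Sum>t\<in>Poly_Mapping.keys f. Poly_Mapping.single t (Poly_Mapping.lookup f t))"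
    by (rule poly_mapping_eqI)
      (simp add: lookup_sum lookup_single when_def not_in_keys_iff_lookup_eq_zero)
  ultimately show ?thesis by (metis finite_keys)
qed

lemma Const_add: "Const (a + b) = Const a + Const b"
  by (simp add: Const_def single_add)

lemma Const_mult: "Const (a * b) = Const a * Const b"
  by (simp add: Const_def mult_single)

lemma Const_0 [simp]: "Const 0 = 0"
  by (simp add: Const_def)

lemma Const_1 [simp]: "Const 1 = 1"
  by (simp add: Const_def)

text \<open>Reduces statements about all polynomials to constants, variables, sums and products, by
  the induction rule that follows it.\<close>

lemma monomial_eq_prod_Var:
  fixes t :: "'x::finite \<Rightarrow>\<^sub>0 nat"
  shows "Poly_Mapping.single t c = Const c * (\<Prod>i\<in>UNIV. Var i ^ Poly_Mapping.lookup t i)"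
proof -
  have pow: "Var i ^ n = Poly_Mapping.single (Poly_Mapping.single i n) 1" for i :: 'x and n
    by (induction n) (auto simp: Var_def mult_single single_add[symmetric])
  have prod: "(\<Prod>i\<in>B. Poly_Mapping.single (a i) (1::complex)) = Poly_Mapping.single (sum a B) 1"
    if "finite B" for B :: "'x set" and a :: "'x \<Rightarrow> 'x \<Rightarrow>\<^sub>0 nat"
    using that by induction (auto simp: mult_single)
  have "(\<Sum>i\<in>UNIV. Poly_Mapping.single i (Poly_Mapping.lookup t i)) = t"
    by (rule poly_mapping_eqI) (simp add: lookup_sum lookup_single when_def)
  then show ?thesis
    by (simp add: pow prod Const_def mult_single)
qed

lemma mpoly_ring_induct [case_names Const Var add mult]:
  fixes f :: "'x::finite mpoly"
  assumes "\<And>c. P (Const c)" and "\<And>i. P (Var i)"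
    and "\<And>f g. P f \<Longrightarrow> P g \<Longrightarrow> P (f + g)" and mult: "\<And>f g. P f \<Longrightarrow> P g \<Longrightarrow> P (f * g)"
  shows "P f"
proof (induction f rule: mpoly_induct)
  case (monomial t c)
  have one: "P 1" using assms(1)[of 1] by simp
  have pow: "P (Var i ^ n)" for i n
    by (induction n) (auto intro: one assms)
  have "P (\<Prod>i\<in>B. Var i ^ Poly_Mapping.lookup t i)" if "finite B" for B
    using that by (induction rule: finite_induct) (auto intro: one pow mult)
  then show ?case
    unfolding monomial_eq_prod_Var by (intro mult assms(1)) simp
next
  case (add f g)
  then show ?case by (rule assms)
qed

locale coefficient_map =
  fixes emb :: "complex \<Rightarrow> 'r::comm_ring_1"
  assumes emb_0: "emb 0 = 0" and emb_1: "emb 1 = 1"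
    and emb_add: "emb (a + b) = emb a + emb b" and emb_mult: "emb (a * b) = emb a * emb b"
begin

lemma msubst_superset:
  assumes "finite K" "Poly_Mapping.keys f \<subseteq> K"
  shows "msubst emb h f =
    (\<Sum>t\<in>K. emb (Poly_Mapping.lookup f t) * (\<Prod>i\<in>UNIV. h i ^ Poly_Mapping.lookup t i))"
  unfolding msubst_def using assms
  by (intro sum.mono_neutral_left) (auto simp: not_in_keys_iff_lookup_eq_zero emb_0)

lemma msubst_add: "msubst emb h (f + g) = msubst emb h f + msubst emb h g"
proof -
  let ?K = "Poly_Mapping.keys f \<union> Poly_Mapping.keys g"
  have "msubst emb h k =
      (\<Sum>t\<in>?K. emb (Poly_Mapping.lookup k t) * (\<Prod>i\<in>UNIV. h i ^ Poly_Mapping.lookup t i))"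
    if "k \<in> {f, g, f + g}" for k
    using that Poly_Mapping.keys_add[of f g] by (intro msubst_superset) auto
  then show ?thesis
    by (simp add: lookup_add emb_add sum.distrib[symmetric] algebra_simps)
qed

lemma msubst_monomial:
  "msubst emb h (Poly_Mapping.single t c) = emb c * (\<Prod>i\<in>UNIV. h i ^ Poly_Mapping.lookup t i)"
  by (subst msubst_superset[of "{t}"]) auto

lemma msubst_mult: "msubst emb h (f * g) = msubst emb h f * msubst emb h g"
proof (induction f rule: mpoly_induct)
  case (monomial s a)
  show ?case
  proof (induction g rule: mpoly_induct)
    case (monomial t b)
    show ?case
      by (simp add: mult_single msubst_monomial emb_mult lookup_add power_add prod.distrib
          algebra_simps)
  qed (simp add: msubst_add algebra_simps)
qed (simp add: msubst_add algebra_simps)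

lemma msubst_Const: "msubst emb h (Const c) = emb c"
  by (simp add: Const_def msubst_monomial)

lemma msubst_Var: "msubst emb h (Var i) = h i"
proof -
  have "(\<Prod>j\<in>UNIV. h j ^ Poly_Mapping.lookup (Poly_Mapping.single i 1) j) = (\<Prod>j\<in>UNIV. if j = i then h j else 1)"
    by (intro prod.cong) (auto simp: lookup_single when_def)
  then show ?thesis
    by (simp add: Var_def msubst_monomial emb_1)
qed

end

interpretation id_coeff: coefficient_map "\<lambda>c::complex. c"
  by unfold_locales auto

interpretation poly_coeff: coefficient_map "\<lambda>c::complex. [:c:]"
  by unfold_locales auto

lemma meval_add [simp]: "meval u (f + g) = meval u f + meval u g"
  by (simp add: meval_def id_coeff.msubst_add)

lemma meval_mult [simp]: "meval u (f * g) = meval u f * meval u g"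
  by (simp add: meval_def id_coeff.msubst_mult)

lemma meval_Const [simp]: "meval u (Const c) = c"
  by (simp add: meval_def id_coeff.msubst_Const)

lemma meval_Var [simp]: "meval u (Var i) = u $ i"
  by (simp add: meval_def id_coeff.msubst_Var)

lemma meval_0 [simp]: "meval u 0 = 0"
  using meval_Const[of u 0] by simp

lemma meval_1 [simp]: "meval u 1 = 1"
  using meval_Const[of u 1] by simp

lemma meval_diff [simp]: "meval u (f - g) = meval u f - meval u g"
  using meval_add[of u "f - g" g] by simp

lemma meval_pscale [simp]: "meval u (pscale c f) = c * meval u f"
  by (simp add: pscale_def)

lemma meval_sum [simp]: "meval u (sum f A) = (\<Sum>a\<in>A. meval u (f a))"
  by (induction A rule: infinite_finite_induct) auto

lemma meval_prod [simp]: "meval u (prod f A) = (\<Prod>a\<in>A. meval u (f a))"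
  by (induction A rule: infinite_finite_induct) auto

lemma meval_power [simp]: "meval u (f ^ n) = meval u f ^ n"
  by (induction n) auto

lemma along_add [simp]: "along u v (f + g) = along u v f + along u v g"
  by (simp add: along_def poly_coeff.msubst_add)

lemma along_mult [simp]: "along u v (f * g) = along u v f * along u v g"
  by (simp add: along_def poly_coeff.msubst_mult)

lemma along_Const [simp]: "along u v (Const c) = [:c:]"
  by (simp add: along_def poly_coeff.msubst_Const)

lemma along_Var: "along u v (Var i) = [:u $ i, v $ i:]"
  by (simp add: along_def poly_coeff.msubst_Var)

lemma along_pscale [simp]: "along u v (pscale c f) = Polynomial.smult c (along u v f)"
  by (simp add: pscale_def)

lemma along_1 [simp]: "along u v 1 = 1"
  using along_Const[of u v 1] by (simp add: one_pCons)

lemma along_prod [simp]: "along u v (prod f A) = (\<Prod>a\<in>A. along u v (f a))"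
  by (induction A rule: infinite_finite_induct) auto

lemma poly_along: "poly (along u v f) t = meval (u + t *s v) f"
  by (induction f rule: mpoly_ring_induct)
    (auto simp: along_Var algebra_simps)

text \<open>Induction on the variables: for fixed values of the others, the sum is a polynomial in one
  variable \<open>a\<close>, and its coefficients are sums over the monomials with a given exponent of \<open>a\<close>.
  Exponents that differ only outside \<open>A\<close> cannot be told apart, hence the injectivity hypothesis.\<close>

lemma eval_monomials_eq_0:
  fixes c :: "('x \<Rightarrow>\<^sub>0 nat) \<Rightarrow> complex"
  assumes "finite A" "finite T"
    and "\<And>s t. s \<in> T \<Longrightarrow> t \<in> T \<Longrightarrow> (\<And>i. i \<in> A \<Longrightarrow> Poly_Mapping.lookup s i = Poly_Mapping.lookup t i) \<Longrightarrow> s = t"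
    and "\<And>u. (\<Sum>t\<in>T. c t * (\<Prod>i\<in>A. u i ^ Poly_Mapping.lookup t i)) = 0"
    and "t \<in> T"
  shows "c t = 0"
  using assms
proof (induction A arbitrary: T t)
  case empty
  then have "T = {t}" by auto
  then show ?case using empty.prems(3) by simp
next
  case (insert a A)
  define T' where "T' = {s \<in> T. Poly_Mapping.lookup s a = Poly_Mapping.lookup t a}"
  show ?case
  proof (rule insert.IH[of T'])
    fix u :: "'x \<Rightarrow> complex"
    define b where "b s = c s * (\<Prod>i\<in>A. u i ^ Poly_Mapping.lookup s i)" for s
    define q where "q = (\<Sum>s\<in>T. Polynomial.monom (b s) (Poly_Mapping.lookup s a))"
    have "poly q z = 0" for z
    proof -
      have "(\<Prod>i\<in>A. (u(a := z)) i ^ Poly_Mapping.lookup s i) = (\<Prod>i\<in>A. u i ^ Poly_Mapping.lookup s i)" for s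
        using insert.hyps by (intro prod.cong) auto
      then have "poly q z = (\<Sum>s\<in>T. c s * (\<Prod>i\<in>insert a A. (u(a := z)) i ^ Poly_Mapping.lookup s i))"
        using insert.hyps
        by (simp add: q_def poly_sum poly_monom b_def algebra_simps del: fun_upd_apply)
           (simp add: algebra_simps)
      then show ?thesis using insert.prems(3) by simp
    qed
    then have "q = 0"
      using poly_all_0_iff_0 by blast
    then have "0 = Polynomial.coeff q (Poly_Mapping.lookup t a)" by simp
    also have "\<dots> = (\<Sum>s\<in>T. if Poly_Mapping.lookup s a = Poly_Mapping.lookup t a then b s else 0)"
      by (simp add: q_def coeff_sum)
    also have "\<dots> = sum b T'"
      unfolding T'_def using insert.prems(1) by (simp add: sum.inter_filter)
    finally show "(\<Sum>s\<in>T'. c s * (\<Prod>i\<in>A. u i ^ Poly_Mapping.lookup s i)) = 0"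
      by (simp add: b_def)
  next
    fix s r assume "s \<in> T'" "r \<in> T'"
      and "\<And>i. i \<in> A \<Longrightarrow> Poly_Mapping.lookup s i = Poly_Mapping.lookup r i"
    then show "s = r" by (intro insert.prems(2)) (auto simp: T'_def)
  qed (use insert.prems in \<open>auto simp: T'_def\<close>)
qed

lemma meval_eq_0_imp_eq_0:
  fixes f :: "'x::finite mpoly"
  assumes "\<And>u. meval u f = 0"
  shows "f = 0"
proof (rule poly_mapping_eqI)
  fix t
  show "Poly_Mapping.lookup f t = Poly_Mapping.lookup 0 t"
  proof (cases "t \<in> Poly_Mapping.keys f")
    case True
    have "Poly_Mapping.lookup f t = 0"
    proof (rule eval_monomials_eq_0[OF finite finite_keys _ _ True])
      fix u :: "'x \<Rightarrow> complex"
      show "(\<Sum>t\<in>Poly_Mapping.keys f. Poly_Mapping.lookup f t * (\<Prod>i\<in>UNIV. u i ^ Poly_Mapping.lookup t i)) = 0"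
        using assms[of "\<chi> i. u i"] by (simp add: meval_def msubst_def)
    qed (auto intro: poly_mapping_eqI)
    then show ?thesis by simp
  qed (simp add: not_in_keys_iff_lookup_eq_zero)
qed

lemma homogeneous_0 [simp]: "homogeneous m 0"
  by (simp add: homogeneous_def)

lemma homogeneous_add: "homogeneous m f \<Longrightarrow> homogeneous m g \<Longrightarrow> homogeneous m (f + g)"
  using Poly_Mapping.keys_add[of f g] by (auto simp: homogeneous_def)

lemma homogeneous_mult:
  assumes "homogeneous m f" "homogeneous n g"
  shows "homogeneous (m + n) (f * g)"
  unfolding homogeneous_def
proof
  fix t assume "t \<in> Poly_Mapping.keys (f * g)"
  then obtain r s where "t = r + s" "r \<in> Poly_Mapping.keys f" "s \<in> Poly_Mapping.keys g"
    using keys_mult[of f g] by auto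
  then show "(\<Sum>i\<in>UNIV. Poly_Mapping.lookup t i) = m + n"
    using assms by (simp add: homogeneous_def lookup_add sum.distrib)
qed

lemma homogeneous_Const: "homogeneous 0 (Const c)"
  by (simp add: homogeneous_def Const_def)

lemma homogeneous_Var: "homogeneous 1 (Var i)"
  by (simp add: homogeneous_def Var_def lookup_single when_def)

lemma homogeneous_pscale: "homogeneous m f \<Longrightarrow> homogeneous m (pscale c f)"
  using homogeneous_mult[OF homogeneous_Const, of m f c] by (simp add: pscale_def)

lemma homogeneous_sum: "(\<And>a. a \<in> A \<Longrightarrow> homogeneous m (f a)) \<Longrightarrow> homogeneous m (sum f A)"
  by (induction A rule: infinite_finite_induct) (auto intro: homogeneous_add)

lemma homogeneous_prod_linear:
  "(\<And>a. a \<in> A \<Longrightarrow> homogeneous 1 (f a)) \<Longrightarrow> finite A \<Longrightarrow> homogeneous (card A) (prod f A)"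
proof (induction A rule: infinite_finite_induct)
  case (insert a A)
  then show ?case using homogeneous_mult[of 1 "f a" "card A" "prod f A"] by simp
qed (use homogeneous_Const[of 1] in auto)

lemma homogeneous_meval_scale:
  assumes "homogeneous m f"
  shows "meval (c *s u) f = c ^ m * meval u f"
  using assms
  by (auto simp: meval_def msubst_def homogeneous_def power_mult_distrib prod.distrib
      sum_distrib_left power_sum[symmetric] intro!: sum.cong)

lemma degree_along_le:
  assumes "homogeneous m f"
  shows "Polynomial.degree (along u v f) \<le> m"
  unfolding along_def msubst_def
proof (rule degree_sum_le)
  fix t assume t: "t \<in> Poly_Mapping.keys f"
  let ?q = "\<Prod>i\<in>UNIV. [:u $ i, v $ i:] ^ Poly_Mapping.lookup t i"
  have "Polynomial.degree ([:u $ i, v $ i:] ^ n) \<le> n" for i n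
    using degree_power_le[of "[:u $ i, v $ i:]" n] by (simp split: if_splits)
  then have "Polynomial.degree ?q \<le> (\<Sum>i\<in>UNIV. Poly_Mapping.lookup t i)"
    by (intro order.trans[OF degree_prod_sum_le sum_mono]) (auto simp: o_def)
  also have "\<dots> = m" using assms t by (simp add: homogeneous_def)
  finally show "Polynomial.degree ([:Poly_Mapping.lookup f t:] * ?q) \<le> m"
    by simp
qed simp

lemma homogeneous_1_imp_linear:
  assumes "homogeneous 1 f"
  shows "meval (a *s u + b *s v) f = a * meval u f + b * meval v f"
proof -
  have eq: "(\<Prod>i\<in>UNIV. (w $ i) ^ Poly_Mapping.lookup t i) = (\<Sum>i\<in>UNIV. of_nat (Poly_Mapping.lookup t i) * w $ i)"
    if "t \<in> Poly_Mapping.keys f" for t and w :: "complex ^ 'a"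
  proof -
    have "(\<Sum>i\<in>UNIV. Poly_Mapping.lookup t i) = 1"
      using assms that by (auto simp: homogeneous_def)
    then obtain k where "Poly_Mapping.lookup t k = 1" "\<And>i. i \<noteq> k \<Longrightarrow> Poly_Mapping.lookup t i = 0"
      using sum_eq_1_iff[of UNIV "Poly_Mapping.lookup t"] by fastforce
    then have "Poly_Mapping.lookup t = (\<lambda>i. if i = k then 1 else 0)" by auto
    then show ?thesis by (simp add: if_distrib if_distribR cong: if_cong)
  qed
  have "meval w f = (\<Sum>t\<in>Poly_Mapping.keys f. Poly_Mapping.lookup f t * (\<Sum>i\<in>UNIV. of_nat (Poly_Mapping.lookup t i) * w $ i))" for w
    by (simp add: meval_def msubst_def eq)
  then show ?thesis
    by (simp add: sum_distrib_left sum.distrib algebra_simps)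
qed

section \<open>Relations between reciprocals of linear forms\<close>

definition linear_form :: "(complex ^ 'm \<Rightarrow> complex) \<Rightarrow> bool" where
  "linear_form a \<longleftrightarrow> (\<forall>r s u v. a (r *s u + s *s v) = r * a u + s * a v)"

lemma linear_formD:
  assumes "linear_form a"
  shows "a (r *s u + s *s v) = r * a u + s * a v" "a (u + s *s v) = a u + s * a v"
    "a (s *s v) = s * a v" "a 0 = 0" "a (u - s *s v) = a u - s * a v"
proof -
  show lin: "a (r *s u + s *s v) = r * a u + s * a v" for r s u v
    using assms by (simp add: linear_form_def)
  show "a (u + s *s v) = a u + s * a v" using lin[of 1 u s v] by simp
  show "a (s *s v) = s * a v" using lin[of s v 0 v] by simp
  show "a 0 = 0" using lin[of 0 v 0 v] by simp
  have "u - s *s v = 1 *s u + (- s) *s v" by simp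
  then show "a (u - s *s v) = a u - s * a v" using lin[of 1 u "- s" v] by simp
qed

lemma subspace_kernel:
  assumes "vec.subspace V" "linear_form f"
  shows "vec.subspace {u \<in> V. f u = 0}"
  using assms(1) linear_formD(2)[OF assms(2), of _ 1] linear_formD(3,4)[OF assms(2)]
  by (auto simp: vec.subspace_def)

text \<open>On a line through \<open>u\<close> a linear form that does not vanish identically has at most one zero,
  so small nonzero steps from \<open>u\<close> leave all the hyperplanes, including those containing \<open>u\<close>.\<close>

lemma eventually_avoids:
  fixes a :: "'n::finite \<Rightarrow> complex ^ 'm \<Rightarrow> complex"
  assumes "\<And>i. i \<in> A \<Longrightarrow> linear_form (a i)" "\<And>i. i \<in> A \<Longrightarrow> a i u \<noteq> 0 \<or> a i v \<noteq> 0"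
  shows "eventually (\<lambda>t. \<forall>i\<in>A. a i (u + t *s v) \<noteq> 0) (at 0)"
proof (rule eventually_ball_finite[OF finite], rule ballI)
  fix i assume i: "i \<in> A"
  have eq: "a i (u + t *s v) = a i u + t * a i v" for t
    using linear_formD(2)[OF assms(1)[OF i]] .
  show "eventually (\<lambda>t. a i (u + t *s v) \<noteq> 0) (at 0)"
  proof (cases "a i u = 0")
    case True
    then have "a i v \<noteq> 0" using assms(2)[OF i] by simp
    then show ?thesis
      by (auto simp: eq True eventually_at_filter)
  next
    case False
    have "((\<lambda>t. a i u + t * a i v) \<longlongrightarrow> a i u + 0 * a i v) (at 0)"
      by (intro tendsto_intros)
    then show ?thesis
      unfolding eq using False by (intro tendsto_imp_eventually_ne) auto
  qed
qed

lemma at_0_obtain: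
  assumes "eventually P (at (0::complex))"
  obtains t where "P t" "t \<noteq> 0"
  using eventually_happens[OF eventually_conj[OF assms eventually_neq_at_within[of 0 0 UNIV]]]
  by auto

text \<open>A vector space over an infinite field is not a finite union of proper subspaces.\<close>

lemma exists_avoiding:
  fixes a :: "'n::finite \<Rightarrow> complex ^ 'm \<Rightarrow> complex"
  assumes V: "vec.subspace V"
    and "\<And>i. i \<in> A \<Longrightarrow> linear_form (a i)" "\<And>i. i \<in> A \<Longrightarrow> \<exists>v\<in>V. a i v \<noteq> 0"
  shows "\<exists>v\<in>V. \<forall>i\<in>A. a i v \<noteq> 0"
  using finite[of A] assms(2,3)
proof (induction A rule: finite_induct)
  case empty
  then show ?case using vec.subspace_0[OF V] by auto
next
  case (insert n A)
  then obtain u where u: "u \<in> V" "\<forall>i\<in>A. a i u \<noteq> 0" by auto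
  obtain v where v: "v \<in> V" "a n v \<noteq> 0" using insert.prems by auto
  have "eventually (\<lambda>t. \<forall>i\<in>insert n A. a i (u + t *s v) \<noteq> 0) (at 0)"
    using insert.prems u v by (intro eventually_avoids) auto
  then obtain t where "\<forall>i\<in>insert n A. a i (u + t *s v) \<noteq> 0" by (rule at_0_obtain)
  moreover have "u + t *s v \<in> V"
    using u v V by (intro vec.subspace_add vec.subspace_scale) auto
  ultimately show ?case by blast
qed

text \<open>The subalgebra generated by the variables in \<open>A\<close>, which takes the place of the polynomial ring
  of the arrangement with index set \<open>A\<close>, so that deletion needs no change of type.\<close>

inductive_set polys_in :: "'n::finite set \<Rightarrow> 'n mpoly set" for A where
  Const: "Const c \<in> polys_in A"
| Var: "i \<in> A \<Longrightarrow> Var i \<in> polys_in A"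
| add: "f \<in> polys_in A \<Longrightarrow> g \<in> polys_in A \<Longrightarrow> f + g \<in> polys_in A"
| mult: "f \<in> polys_in A \<Longrightarrow> g \<in> polys_in A \<Longrightarrow> f * g \<in> polys_in A"

lemma polys_in_UNIV: "f \<in> polys_in UNIV"
  by (induction f rule: mpoly_ring_induct) (auto intro: polys_in.intros)

lemma polys_in_mono: "f \<in> polys_in A \<Longrightarrow> A \<subseteq> B \<Longrightarrow> f \<in> polys_in B"
  by (induction rule: polys_in.induct) (auto intro: polys_in.intros)

lemma polys_in_0: "0 \<in> polys_in A"
  using polys_in.Const[of 0 A] by simp

lemma polys_in_1: "1 \<in> polys_in A"
  using polys_in.Const[of 1 A] by simp

lemma polys_in_minus: "f \<in> polys_in A \<Longrightarrow> - f \<in> polys_in A"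
proof -
  have "Const (- 1) + 1 = (0 :: 'a mpoly)"
    using Const_add[of "- 1" 1] by simp
  then have "Const (- 1) = (- 1 :: 'a mpoly)"
    by (simp add: eq_neg_iff_add_eq_0)
  then show "f \<in> polys_in A \<Longrightarrow> - f \<in> polys_in A"
    using polys_in.mult[OF polys_in.Const[of "- 1"], of f A] by simp
qed

lemma polys_in_diff: "f \<in> polys_in A \<Longrightarrow> g \<in> polys_in A \<Longrightarrow> f - g \<in> polys_in A"
  using polys_in.add[of f A "- g"] polys_in_minus[of g A] by simp

lemma polys_in_sum: "(\<And>x. x \<in> S \<Longrightarrow> f x \<in> polys_in A) \<Longrightarrow> sum f S \<in> polys_in A"
  by (induction S rule: infinite_finite_induct) (auto intro: polys_in_0 polys_in.add)

lemma polys_in_prod: "(\<And>x. x \<in> S \<Longrightarrow> f x \<in> polys_in A) \<Longrightarrow> prod f S \<in> polys_in A"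
  by (induction S rule: infinite_finite_induct) (auto intro: polys_in_1 polys_in.mult)

lemma polys_in_power: "f \<in> polys_in A \<Longrightarrow> f ^ n \<in> polys_in A"
  by (induction n) (auto intro: polys_in_1 polys_in.mult)

text \<open>Every polynomial in the variables \<open>insert n A\<close> is a polynomial in the variable \<open>n\<close> with coefficients
  free of it; these presentations are closed under sums and products because univariate
  polynomials are.\<close>

lemma polys_in_insert:
  assumes "f \<in> polys_in (insert n A)"
  shows "\<exists>M G. (\<forall>m. G m \<in> polys_in A) \<and> f = (\<Sum>m\<le>M. G m * Var n ^ m)"
proof -
  have "\<exists>P. (\<forall>m. Polynomial.coeff P m \<in> polys_in A) \<and> f = poly P (Var n)"
    using assms
  proof (induction rule: polys_in.induct)
    case (Const c)
    show ?case
      by (rule exI[of _ "[:Const c:]"])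
        (auto simp: coeff_pCons polys_in_0 polys_in.Const split: nat.split)
  next
    case (Var i)
    show ?case
    proof (cases "i = n")
      case True
      then show ?thesis
        by (intro exI[of _ "[:0, 1:]"])
          (auto simp: coeff_pCons polys_in_0 polys_in_1 split: nat.split)
    next
      case False
      then show ?thesis using Var
        by (intro exI[of _ "[:Var i:]"])
          (auto simp: coeff_pCons polys_in_0 polys_in.Var split: nat.split)
    qed
  next
    case (add f g)
    then obtain P Q where "\<forall>m. Polynomial.coeff P m \<in> polys_in A" "f = poly P (Var n)"
      "\<forall>m. Polynomial.coeff Q m \<in> polys_in A" "g = poly Q (Var n)" by blast
    then show ?case by (intro exI[of _ "P + Q"]) (auto intro: polys_in.add)
  next
    case (mult f g)
    then obtain P Q where "\<forall>m. Polynomial.coeff P m \<in> polys_in A" "f = poly P (Var n)"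
      "\<forall>m. Polynomial.coeff Q m \<in> polys_in A" "g = poly Q (Var n)" by blast
    then show ?case
      by (intro exI[of _ "P * Q"]) (auto simp: coeff_mult intro: polys_in.mult polys_in_sum)
  qed
  then obtain P where "\<forall>m. Polynomial.coeff P m \<in> polys_in A" "f = poly P (Var n)" by blast
  then show ?thesis
    by (intro exI[of _ "Polynomial.degree P"] exI[of _ "Polynomial.coeff P"])
      (auto simp: poly_altdef)
qed

definition reciprocals :: "('n \<Rightarrow> complex ^ 'm \<Rightarrow> complex) \<Rightarrow> complex ^ 'm \<Rightarrow> complex ^ 'n" where
  "reciprocals a u = (\<chi> i. 1 / a i u)"

lemma polys_in_empty_constant: "f \<in> polys_in {} \<Longrightarrow> \<exists>c. f = Const c"
  by (induction rule: polys_in.induct) (auto simp flip: Const_add Const_mult)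

lemma tendsto_meval_reciprocals:
  fixes a :: "'n::finite \<Rightarrow> complex ^ 'm \<Rightarrow> complex"
  assumes "f \<in> polys_in A" "\<And>i. i \<in> A \<Longrightarrow> linear_form (a i)" "\<And>i. i \<in> A \<Longrightarrow> a i u \<noteq> 0"
  shows "((\<lambda>t. meval (reciprocals a (u + t *s v)) f) \<longlongrightarrow> meval (reciprocals a u) f) (at 0)"
  using assms
proof (induction rule: polys_in.induct)
  case (Var i)
  have "((\<lambda>t. 1 / (a i u + t * a i v)) \<longlongrightarrow> 1 / (a i u + 0 * a i v)) (at 0)"
    using Var by (intro tendsto_intros) auto
  then show ?case using Var by (simp add: reciprocals_def linear_formD)
qed (auto intro!: tendsto_intros)

lemma meval_OT_relation:
  "meval w (OT_relation J c) = (\<Sum>j\<in>J. c j * (\<Prod>i\<in>J - {j}. w $ i))"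
  by (simp add: OT_relation_def)

text \<open>Dividing \<open>f\<^sub>\<Lambda>\<close> by the product of its variables turns it into \<open>\<Sum> c\<^sub>j / y\<^sub>j\<close>. The common factor \<open>s\<close>
  is what allows limits of rescaled vectors of reciprocals to be taken.\<close>

lemma OT_relation_vanishes:
  fixes w :: "complex ^ 'n::finite"
  assumes "\<And>i. w $ i = s / b i" "s \<noteq> 0" "\<And>i. i \<in> J \<Longrightarrow> b i \<noteq> 0" "(\<Sum>j\<in>J. c j * b j) = 0"
  shows "meval w (OT_relation J c) = 0"
proof -
  have "c j * (\<Prod>i\<in>J - {j}. w $ i) = (\<Prod>i\<in>J. w $ i) / s * (c j * b j)" if "j \<in> J" for j
    using prod.remove[OF finite that, of "\<lambda>i. w $ i"] assms(2) assms(3)[OF that] assms(1)[of j] by simp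
  then have "meval w (OT_relation J c) = (\<Prod>i\<in>J. w $ i) / s * (\<Sum>j\<in>J. c j * b j)"
    by (simp add: meval_OT_relation sum_distrib_left)
  then show ?thesis using assms by simp
qed

text \<open>The Orlik-Terao ideal of the restrictions to \<open>V\<close> of the forms with index in \<open>A\<close>. The multipliers
  \<open>g\<close> are confined to the variables in \<open>A\<close>: the restriction step multiplies by \<open>y\<^sub>n\<close> and has to stay
  linear in \<open>y\<^sub>n\<close>.\<close>

inductive_set OT_on ::
    "(complex ^ 'm) set \<Rightarrow> ('n::finite \<Rightarrow> complex ^ 'm \<Rightarrow> complex) \<Rightarrow> 'n set \<Rightarrow> 'n mpoly set"
  for V a A where
  zero: "0 \<in> OT_on V a A"
| step: "x \<in> OT_on V a A \<Longrightarrow> g \<in> polys_in A \<Longrightarrow> J \<subseteq> A \<Longrightarrow> \<forall>u\<in>V. (\<Sum>j\<in>J. c j * a j u) = 0 \<Longrightarrow>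
    x + g * OT_relation J c \<in> OT_on V a A"

lemma OT_on_add: "y \<in> OT_on V a A \<Longrightarrow> x \<in> OT_on V a A \<Longrightarrow> x + y \<in> OT_on V a A"
proof (induction y rule: OT_on.induct)
  case (step y g J c)
  then show ?case using OT_on.step[of "x + y" V a A g J c] by (simp add: add.assoc)
qed simp

lemma OT_on_mult: "x \<in> OT_on V a A \<Longrightarrow> f \<in> polys_in A \<Longrightarrow> f * x \<in> OT_on V a A"
proof (induction x rule: OT_on.induct)
  case (step x g J c)
  then show ?case
    using OT_on.step[of "f * x" V a A "f * g" J c] by (simp add: polys_in.mult algebra_simps)
qed (simp add: OT_on.zero)

lemma OT_on_mono: "x \<in> OT_on V a A \<Longrightarrow> A \<subseteq> B \<Longrightarrow> x \<in> OT_on V a B"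
proof (induction x rule: OT_on.induct)
  case (step x g J c)
  then show ?case by (intro OT_on.step) (auto intro: polys_in_mono)
qed (simp add: OT_on.zero)

lemma OT_on_vanishes:
  assumes "x \<in> OT_on V a A" "u \<in> V" "\<And>i. i \<in> A \<Longrightarrow> a i u \<noteq> 0"
  shows "meval (reciprocals a u) x = 0"
  using assms
proof (induction x rule: OT_on.induct)
  case (step x g J c)
  then have "meval (reciprocals a u) (OT_relation J c) = 0"
    by (intro OT_relation_vanishes[where s = 1 and b = "\<lambda>i. a i u"]) (auto simp: reciprocals_def)
  then show ?case using step by simp
qed simp

text \<open>If \<open>\<Sum> c\<^sub>j \<alpha>\<^sub>j = 0\<close> on the hyperplane \<open>\<alpha>\<^sub>n = 0\<close>, then \<open>\<Sum> c\<^sub>j \<alpha>\<^sub>j + e \<alpha>\<^sub>n = 0\<close> on \<open>V\<close> for some \<open>e\<close>, and the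
  relation of the latter is \<open>y\<^sub>n\<close> times the relation of the former plus \<open>e\<close> times a monomial without
  \<open>y\<^sub>n\<close>.\<close>

lemma lift_restricted_relation:
  assumes lin: "\<And>i. i \<in> insert n A \<Longrightarrow> linear_form (a i)" and n: "n \<notin> A"
    and V: "vec.subspace V" and v0: "v0 \<in> V" "a n v0 = 1"
    and "G \<in> OT_on {u \<in> V. a n u = 0} a A"
  shows "\<exists>H\<in>polys_in A. Var n * G - H \<in> OT_on V a (insert n A)"
  using assms(6)
proof (induction G rule: OT_on.induct)
  case zero
  then show ?case by (auto intro!: bexI[of _ 0] OT_on.zero polys_in_0)
next
  case (step x g J c)
  then obtain H where H: "H \<in> polys_in A" "Var n * x - H \<in> OT_on V a (insert n A)" by blast
  have nJ: "n \<notin> J" using n step by auto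
  define e where "e = - (\<Sum>j\<in>J. c j * a j v0)"
  have dep: "(\<Sum>j\<in>J. c j * a j u) + e * a n u = 0" if u: "u \<in> V" for u
  proof -
    define w where "w = u - a n u *s v0"
    have "a n w = 0"
      using lin[of n] v0 by (simp add: w_def linear_formD)
    moreover have "w \<in> V"
      unfolding w_def using u V v0 by (intro vec.subspace_diff vec.subspace_scale) auto
    ultimately have "(\<Sum>j\<in>J. c j * a j w) = 0" using step by auto
    moreover have "a j w = a j u - a n u * a j v0" if "j \<in> J" for j
      using that step lin[of j] by (auto simp: w_def linear_formD)
    ultimately show ?thesis
      by (simp add: e_def right_diff_distrib sum_subtractf sum_distrib_left sum_distrib_right
          algebra_simps)
  qed
  define c' where "c' = c(n := e)"
  have "(\<Sum>j\<in>insert n J. c' j * a j u) = 0" if "u \<in> V" for u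
  proof -
    have "(\<Sum>j\<in>J. c' j * a j u) = (\<Sum>j\<in>J. c j * a j u)"
      using nJ by (intro sum.cong) (auto simp: c'_def)
    then show ?thesis using dep[OF that] nJ by (simp add: c'_def add.commute)
  qed
  then have "(Var n * x - H) + g * OT_relation (insert n J) c' \<in> OT_on V a (insert n A)"
    using step H by (intro OT_on.step) (auto intro: polys_in_mono)
  moreover have "OT_relation (insert n J) c' = pscale e (\<Prod>i\<in>J. Var i) + Var n * OT_relation J c"
  proof -
    have "(\<Prod>i\<in>insert n J - {j}. Var i) = Var n * (\<Prod>i\<in>J - {j}. Var i :: 'a mpoly)" if "j \<in> J" for j
      using nJ that by (subst insert_Diff_if) auto
    then have "pscale (c' j) (\<Prod>i\<in>insert n J - {j}. Var i)
        = Var n * pscale (c j) (\<Prod>i\<in>J - {j}. Var i)" if "j \<in> J" for j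
      using that nJ by (auto simp: c'_def pscale_def algebra_simps)
    moreover have "insert n J - {n} = J" using nJ by auto
    ultimately show ?thesis
      using nJ by (simp add: OT_relation_def sum_distrib_left) (simp add: c'_def)
  qed
  moreover have "H - g * pscale e (\<Prod>i\<in>J. Var i) \<in> polys_in A"
    unfolding pscale_def using H step
    by (intro polys_in_diff polys_in.mult polys_in_prod polys_in.Const) (auto intro: polys_in.Var)
  ultimately show ?case
    by (intro bexI[of _ "H - g * pscale e (\<Prod>i\<in>J. Var i)"]) (auto simp: algebra_simps)
qed

text \<open>A form proportional to \<open>\<alpha>\<^sub>n\<close> restricts to \<open>0\<close>, which the induction cannot handle; but then the
  two-term dependency already makes \<open>y\<^sub>n\<close> congruent to a multiple of \<open>y\<^sub>i\<close>.\<close>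

lemma parallel_reduction:
  assumes lin: "\<And>i. i \<in> insert n A \<Longrightarrow> linear_form (a i)" and n: "n \<notin> A"
    and V: "vec.subspace V" and v0: "v0 \<in> V" "a n v0 = 1"
    and i: "i \<in> A" "\<forall>u\<in>V. a n u = 0 \<longrightarrow> a i u = 0" and G: "G \<in> polys_in A"
  shows "\<exists>H\<in>polys_in A. Var n * G - H \<in> OT_on V a (insert n A)"
proof -
  define c where "c j = (if j = n then - a i v0 else 1)" for j
  have ni: "n \<noteq> i" using n i by auto
  have dep: "(\<Sum>j\<in>{n, i}. c j * a j u) = 0" if u: "u \<in> V" for u
  proof -
    define w where "w = u - a n u *s v0"
    have "a n w = 0"
      using lin[of n] v0 by (simp add: w_def linear_formD)
    moreover have "w \<in> V"
      unfolding w_def using u V v0 by (intro vec.subspace_diff vec.subspace_scale) auto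
    ultimately have "a i w = 0" using i by auto
    moreover have "a i w = a i u - a n u * a i v0"
      using i lin[of i] by (auto simp: w_def linear_formD)
    ultimately show ?thesis using ni by (simp add: c_def)
  qed
  have "0 + G * OT_relation {n, i} c \<in> OT_on V a (insert n A)"
    using dep i G by (intro OT_on.step OT_on.zero) (auto intro: polys_in_mono)
  moreover have "OT_relation {n, i} c = Var n - Const (a i v0) * Var i"
  proof -
    have "{n, i} - {n} = {i}" "{n, i} - {i} = {n}" using ni by auto
    moreover have "Const (- a i v0) = (- Const (a i v0) :: 'a mpoly)"
      using Const_add[of "- a i v0" "a i v0"] by (simp add: eq_neg_iff_add_eq_0)
    ultimately show ?thesis using ni by (simp add: OT_relation_def c_def pscale_def)
  qed
  ultimately show ?thesis using i G
    by (intro bexI[of _ "Const (a i v0) * Var i * G"])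
      (auto simp: algebra_simps intro!: polys_in.intros)
qed

text \<open>Deletion and restriction. The induction removes one form \<open>\<alpha>\<^sub>n\<close> and is over all subspaces \<open>V\<close>, since
  it is applied both to \<open>V\<close> (deletion) and to the hyperplane \<open>W\<close> of \<open>V\<close> where \<open>\<alpha>\<^sub>n = 0\<close> (restriction).\<close>

theorem vanishing_at_reciprocals_imp_OT_on:
  fixes a :: "'n::finite \<Rightarrow> complex ^ 'm \<Rightarrow> complex"
  assumes "vec.subspace V"
    and "\<And>i. i \<in> A \<Longrightarrow> linear_form (a i)" and "\<And>i. i \<in> A \<Longrightarrow> \<exists>v\<in>V. a i v \<noteq> 0"
    and "F \<in> polys_in A"
    and "\<And>u. u \<in> V \<Longrightarrow> \<forall>i\<in>A. a i u \<noteq> 0 \<Longrightarrow> meval (reciprocals a u) F = 0"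
  shows "F \<in> OT_on V a A"
  using finite[of A] assms
proof (induction A arbitrary: V F rule: finite_induct)
  case empty
  then obtain c where "F = Const c" using polys_in_empty_constant by blast
  moreover have "meval (reciprocals a 0) F = 0"
    using empty.prems vec.subspace_0 by blast
  ultimately show ?case by (simp add: OT_on.zero)
next
  case (insert n A)
  note V = \<open>vec.subspace V\<close> and lin = insert.prems(2) and IH = insert.IH
  obtain v where v: "v \<in> V" "a n v \<noteq> 0" using insert.prems(3) by blast
  define v0 where "v0 = (1 / a n v) *s v"
  have v0: "v0 \<in> V" "a n v0 = 1"
    using v V lin[of n] by (auto simp: v0_def linear_formD intro: vec.subspace_scale)
  define W where "W = {u \<in> V. a n u = 0}"
  have W: "vec.subspace W"
    unfolding W_def using V lin[of n] by (intro subspace_kernel) auto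
  have avoids: "eventually (\<lambda>t. \<forall>i\<in>insert n A. a i (u + t *s v0) \<noteq> 0) (at 0)"
    if "\<forall>i\<in>A. a i u \<noteq> 0" for u
    using that lin v0 by (intro eventually_avoids) auto
  have reduce: "\<exists>H\<in>polys_in A. Var n * G - H \<in> OT_on V a (insert n A)"
    if G: "G \<in> polys_in A"
      and vanish: "\<And>u. u \<in> W \<Longrightarrow> \<forall>i\<in>A. a i u \<noteq> 0 \<Longrightarrow> meval (reciprocals a u) G = 0" for G
  proof (cases "\<exists>i\<in>A. \<forall>u\<in>W. a i u = 0")
    case True
    then obtain i where "i \<in> A" "\<forall>u\<in>V. a n u = 0 \<longrightarrow> a i u = 0" by (auto simp: W_def)
    then show ?thesis
      using parallel_reduction[of n A a V v0 i G] lin insert.hyps V v0 G by blast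
  next
    case False
    then have "G \<in> OT_on W a A"
      using W lin G vanish by (intro IH) auto
    then show ?thesis
      using lift_restricted_relation[of n A a V v0 G] lin insert.hyps V v0 by (simp add: W_def)
  qed
  have main: "(\<Sum>m\<le>M. G m * Var n ^ m) \<in> OT_on V a (insert n A)"
    if "\<forall>m. G m \<in> polys_in A"
      and "\<And>u. u \<in> V \<Longrightarrow> \<forall>i\<in>insert n A. a i u \<noteq> 0 \<Longrightarrow>
        meval (reciprocals a u) (\<Sum>m\<le>M. G m * Var n ^ m) = 0" for M G
    using that
  proof (induction M arbitrary: G)
    case 0
    have "meval (reciprocals a u) (G 0) = 0" if u: "u \<in> V" "\<forall>i\<in>A. a i u \<noteq> 0" for u
    proof -
      have "eventually (\<lambda>t. meval (reciprocals a (u + t *s v0)) (G 0) = 0) (at 0)"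
        using avoids[OF u(2)]
      proof eventually_elim
        case (elim t)
        have "u + t *s v0 \<in> V" using u v0 V by (intro vec.subspace_add vec.subspace_scale) auto
        then show ?case using "0.prems"(2)[OF _ elim] by simp
      qed
      then have "((\<lambda>t. meval (reciprocals a (u + t *s v0)) (G 0)) \<longlongrightarrow> 0) (at 0)"
        by (rule tendsto_eventually)
      moreover have "((\<lambda>t. meval (reciprocals a (u + t *s v0)) (G 0)) \<longlongrightarrow> meval (reciprocals a u) (G 0)) (at 0)"
        using "0.prems" lin u by (intro tendsto_meval_reciprocals[of _ A]) auto
      ultimately show ?thesis using tendsto_unique[OF at_neq_bot] by blast
    qed
    then have "G 0 \<in> OT_on V a A"
      using V lin insert.prems(3) "0.prems"(1) by (intro IH) auto
    then show ?case by (auto intro: OT_on_mono)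
  next
    case (Suc M)
    have "meval (reciprocals a u) (G (Suc M)) = 0" if u: "u \<in> W" "\<forall>i\<in>A. a i u \<noteq> 0" for u
    proof -
      let ?g = "\<lambda>t m. meval (reciprocals a (u + t *s v0)) (G m)"
      have "a n u = 0" "u \<in> V" using u by (auto simp: W_def)
      \<comment> \<open>Multiplying by \<open>\<alpha>\<^sub>n ^ (M + 1)\<close> leaves only the leading coefficient in the limit.\<close>
      have "eventually (\<lambda>t. (\<Sum>m\<le>M. ?g t m * t ^ (Suc M - m)) + ?g t (Suc M) = 0) (at 0)"
        using avoids[OF u(2)] eventually_neq_at_within[of 0 0 UNIV]
      proof eventually_elim
        case (elim t)
        have "u + t *s v0 \<in> V"
          using \<open>u \<in> V\<close> v0 V by (intro vec.subspace_add vec.subspace_scale) auto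
        have "a n (u + t *s v0) = t" using lin[of n] \<open>a n u = 0\<close> v0 by (simp add: linear_formD)
        then have "0 = t ^ Suc M * (\<Sum>m\<le>Suc M. ?g t m * (1 / t) ^ m)"
          using Suc.prems(2)[OF \<open>u + t *s v0 \<in> V\<close> elim(1)]
          by (simp add: reciprocals_def del: sum.atMost_Suc power_Suc)
        also have "\<dots> = (\<Sum>m\<le>Suc M. ?g t m * t ^ (Suc M - m))"
          unfolding sum_distrib_left
        proof (rule sum.cong)
          fix m assume "m \<in> {..Suc M}"
          then have "t ^ Suc M = t ^ (Suc M - m) * t ^ m" by (simp add: power_add[symmetric])
          then show "t ^ Suc M * (?g t m * (1 / t) ^ m) = ?g t m * t ^ (Suc M - m)"
            using elim(2) by (simp add: power_one_over del: power_Suc)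
        qed simp
        finally show ?case by simp
      qed
      then have lim0: "((\<lambda>t. (\<Sum>m\<le>M. ?g t m * t ^ (Suc M - m)) + ?g t (Suc M)) \<longlongrightarrow> 0) (at 0)"
        by (rule tendsto_eventually)
      have lim: "((\<lambda>t. (\<Sum>m\<le>M. ?g t m * t ^ (Suc M - m)) + ?g t (Suc M)) \<longlongrightarrow>
          (\<Sum>m\<le>M. meval (reciprocals a u) (G m) * 0 ^ (Suc M - m)) + meval (reciprocals a u) (G (Suc M))) (at 0)"
        using Suc.prems lin u
        by (intro tendsto_intros tendsto_meval_reciprocals[of _ A]) auto
      have "(\<Sum>m\<le>M. meval (reciprocals a u) (G m) * 0 ^ (Suc M - m)) = 0"
        by (intro sum.neutral) (auto simp: power_0_left)
      then show ?thesis
        using tendsto_unique[OF at_neq_bot lim lim0] by simp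
    qed
    then obtain H where H: "H \<in> polys_in A" "Var n * G (Suc M) - H \<in> OT_on V a (insert n A)"
      using reduce[of "G (Suc M)"] Suc.prems(1) by blast
    \<comment> \<open>Modulo the ideal, \<open>G (M + 1) y\<^sub>n ^ (M + 1)\<close> becomes \<open>H y\<^sub>n ^ M\<close>.\<close>
    define G' where "G' = G(M := G M + H)"
    define E where "E = Var n ^ M * (Var n * G (Suc M) - H)"
    have E: "E \<in> OT_on V a (insert n A)"
      unfolding E_def using H by (intro OT_on_mult polys_in_power polys_in.Var) auto
    have "(\<Sum>m\<le>M. G' m * Var n ^ m) = (\<Sum>m\<le>M. G m * Var n ^ m + (if m = M then H * Var n ^ m else 0))"
      by (intro sum.cong) (auto simp: G'_def algebra_simps)
    also have "\<dots> = (\<Sum>m\<le>M. G m * Var n ^ m) + H * Var n ^ M"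
      by (simp add: sum.distrib)
    finally have eq: "(\<Sum>m\<le>Suc M. G m * Var n ^ m) = (\<Sum>m\<le>M. G' m * Var n ^ m) + E"
      by (simp add: E_def algebra_simps)
    have "(\<Sum>m\<le>M. G' m * Var n ^ m) \<in> OT_on V a (insert n A)"
    proof (rule Suc.IH)
      show "\<forall>m. G' m \<in> polys_in A"
        using Suc.prems(1) H by (auto simp: G'_def intro: polys_in.add)
    next
      fix u assume u: "u \<in> V" "\<forall>i\<in>insert n A. a i u \<noteq> 0"
      show "meval (reciprocals a u) (\<Sum>m\<le>M. G' m * Var n ^ m) = 0"
        using Suc.prems(2)[OF u, unfolded eq] OT_on_vanishes[OF E u(1)] u(2) by simp
    qed
    then show ?case unfolding eq by (rule OT_on_add[OF E])
  qed
  obtain M G where G: "\<forall>m. G m \<in> polys_in A" and F: "F = (\<Sum>m\<le>M. G m * Var n ^ m)"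
    using polys_in_insert[OF insert.prems(4)] by blast
  show ?case
    unfolding F by (rule main[OF G]) (use insert.prems(5) F in auto)
qed

section \<open>Ideals of polynomials and orders of vanishing\<close>

interpretation ps: vector_space "pscale :: complex \<Rightarrow> 'x mpoly \<Rightarrow> 'x mpoly"
  by (rule vector_space_pscale)

interpretation mp: cring "poly_ring :: 'x mpoly ring"
  rewrites "carrier (poly_ring :: 'x mpoly ring) = UNIV"
    and "(\<otimes>\<^bsub>poly_ring :: 'x mpoly ring\<^esub>) = (*)"
    and "(\<oplus>\<^bsub>poly_ring :: 'x mpoly ring\<^esub>) = (+)"
    and "\<zero>\<^bsub>poly_ring :: 'x mpoly ring\<^esub> = 0"
  by (rule cring_from_type_algebra) (simp_all add: ring_of_type_algebra_def)

lemma poly_ring_simps: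
  "carrier (poly_ring :: 'x mpoly ring) = UNIV"
  "(\<otimes>\<^bsub>poly_ring :: 'x mpoly ring\<^esub>) = (*)"
  "(\<oplus>\<^bsub>poly_ring :: 'x mpoly ring\<^esub>) = (+)"
  "\<zero>\<^bsub>poly_ring :: 'x mpoly ring\<^esub> = 0"
  by (simp_all add: ring_of_type_algebra_def)

lemma poly_idealI:
  fixes I :: "'x mpoly set"
  assumes "0 \<in> I" "\<And>f g. f \<in> I \<Longrightarrow> g \<in> I \<Longrightarrow> f + g \<in> I" "\<And>f g. f \<in> I \<Longrightarrow> g * f \<in> I"
  shows "ideal I poly_ring"
proof (rule idealI)
  show "ring (poly_ring :: 'x mpoly ring)" by (rule ring_from_type_algebra)
  show "subgroup I (add_monoid poly_ring)"
  proof (rule group.subgroupI)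
    show "group (add_monoid (poly_ring :: 'x mpoly ring))"
      by (rule abelian_group.a_group[OF ring.is_abelian_group[OF ring_from_type_algebra]])
    fix f assume f: "f \<in> I"
    have "\<ominus>\<^bsub>poly_ring\<^esub> f = - f"
      by (rule mp.minus_equality) (simp_all add: poly_ring_simps)
    then show "inv\<^bsub>add_monoid poly_ring\<^esub> f \<in> I"
      using assms(3)[OF f, of "- 1"] by (simp add: a_inv_def)
  qed (use assms in \<open>auto simp: poly_ring_simps\<close>)
qed (use assms in \<open>auto simp: poly_ring_simps mult.commute\<close>)

lemma poly_idealD:
  fixes I :: "'x mpoly set"
  assumes "ideal I poly_ring"
  shows "0 \<in> I" "f \<in> I \<Longrightarrow> g \<in> I \<Longrightarrow> f + g \<in> I" "f \<in> I \<Longrightarrow> g * f \<in> I"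
  using additive_subgroup.zero_closed[OF ideal.axioms(1)[OF assms]]
    additive_subgroup.a_closed[OF ideal.axioms(1)[OF assms]] ideal.I_l_closed[OF assms]
  by (simp_all add: poly_ring_simps)

lemma genideal_poly_ring:
  fixes S :: "'x mpoly set"
  shows "ideal (Idl\<^bsub>poly_ring\<^esub> S) poly_ring" "S \<subseteq> Idl\<^bsub>poly_ring\<^esub> S"
    "ideal I poly_ring \<Longrightarrow> S \<subseteq> I \<Longrightarrow> Idl\<^bsub>poly_ring\<^esub> S \<subseteq> I"
  using mp.genideal_ideal[of S] mp.genideal_self[of S] mp.genideal_minimal[of I S] by auto

lemma ideal_power_is_ideal:
  fixes I :: "'x mpoly set"
  assumes "ideal I poly_ring"
  shows "ideal (ideal_power poly_ring I k) poly_ring"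
proof (induction k)
  case 0
  show ?case by (auto intro: poly_idealI simp: poly_ring_simps)
next
  case (Suc k)
  then show ?case using mp.ideal_prod_is_ideal[OF assms] by simp
qed

lemma prod_in_ideal_power:
  fixes f :: "'i \<Rightarrow> 'x mpoly"
  assumes "finite K" "\<And>j. j \<in> K \<Longrightarrow> f j \<in> I"
  shows "prod f K \<in> ideal_power poly_ring I (card K)"
  using assms
proof (induction K rule: finite_induct)
  case (insert j K)
  then show ?case
    using ideal_prod.prod[of "f j" I "prod f K" "ideal_power poly_ring I (card K)" poly_ring]
    by (simp add: poly_ring_simps)
qed (simp add: poly_ring_simps)

lemma homogeneous_in_vanishing_ideal:
  "homogeneous m f \<Longrightarrow> (\<And>p. p \<in> Y \<Longrightarrow> vanishes_at f p) \<Longrightarrow> f \<in> vanishing_ideal Y"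
  unfolding vanishing_ideal_def by (rule subsetD[OF genideal_poly_ring(2)]) auto

lemma vanishing_ideal_meval:
  assumes "f \<in> vanishing_ideal {p}" "u \<in> p"
  shows "meval u f = 0"
proof -
  have "vanishing_ideal {p} \<subseteq> {f. meval u f = 0}"
    unfolding vanishing_ideal_def using assms(2)
    by (intro genideal_poly_ring(3) poly_idealI) (auto simp: vanishes_at_def)
  then show ?thesis using assms(1) by auto
qed

lemma ideal_power_vanishing_order:
  assumes "f \<in> ideal_power poly_ring (vanishing_ideal {p}) k" "u + t *s v \<in> p"
  shows "[:- t, 1:] ^ k dvd along u v f"
  using assms(1)
proof (induction k arbitrary: f)
  case (Suc k)
  from Suc.prems have "f \<in> ideal_prod poly_ring (vanishing_ideal {p}) (ideal_power poly_ring (vanishing_ideal {p}) k)"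
    by simp
  then show ?case
  proof (induction rule: ideal_prod.induct)
    case (prod g h)
    have "[:- t, 1:] dvd along u v g"
      using vanishing_ideal_meval[OF prod(1) assms(2)] by (simp add: poly_along flip: poly_eq_0_iff_dvd)
    then show ?case
      using Suc.IH[OF prod(2)] by (simp add: poly_ring_simps mult_dvd_mono del: mult_pCons_left)
  qed (simp add: poly_ring_simps)
qed simp

text \<open>Proportional factors occur here: they come from different lines of the arrangement that pass through the same
  point. Hence divisibility must be checked with multiplicities, root by root.\<close>

lemma prod_linear_dvd:
  fixes a b :: "'i \<Rightarrow> complex"
  assumes "finite A" "\<And>j. j \<in> A \<Longrightarrow> b j \<noteq> 0"
    and "\<And>t. [:- t, 1:] ^ card {j \<in> A. a j + t * b j = 0} dvd F"
  shows "(\<Prod>j\<in>A. [:a j, b j:]) dvd F"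
  using assms
proof (induction A arbitrary: F rule: finite_induct)
  case (insert k A)
  define r where "r = - a k / b k"
  have bk: "b k \<noteq> 0" using insert.prems by simp
  have rk: "a k + t * b k = 0 \<longleftrightarrow> t = r" for t
  proof -
    have "a k + t * b k = b k * (t - r)" using bk by (simp add: r_def distrib_left mult.commute)
    then show ?thesis using bk by simp
  qed
  have card: "card {j \<in> insert k A. a j + t * b j = 0}
      = (if t = r then 1 else 0) + card {j \<in> A. a j + t * b j = 0}" for t
  proof -
    have "{j \<in> insert k A. a j + t * b j = 0} =
        (if t = r then insert k {j \<in> A. a j + t * b j = 0} else {j \<in> A. a j + t * b j = 0})"
      using rk by auto
    then show ?thesis using insert.hyps by simp
  qed
  have "[:- r, 1:] dvd F"
    using insert.prems(2)[of r] unfolding card by (auto dest: dvd_mult_left simp del: mult_pCons_left)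
  then obtain G where F: "F = [:- r, 1:] * G" by (auto elim: dvdE)
  have "[:- t, 1:] ^ card {j \<in> A. a j + t * b j = 0} dvd G" for t
  proof (cases "t = r \<or> G = 0")
    case True
    then show ?thesis
      using insert.prems(2)[of t] unfolding card F
      by (auto simp del: mult_pCons_left)
  next
    case False
    then have "F \<noteq> 0" by (simp add: F del: mult_pCons_left)
    then have "card {j \<in> A. a j + t * b j = 0} \<le> Polynomial.order t F"
      using insert.prems(2)[of t] False unfolding card by (simp add: order_divides)
    also have "Polynomial.order t F = Polynomial.order t [:- r, 1:] + Polynomial.order t G"
      using \<open>F \<noteq> 0\<close> unfolding F by (rule order_mult)
    also have "Polynomial.order t [:- r, 1:] = 0"
      using False by (intro order_0I) auto
    finally show ?thesis by (simp add: order_divides)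
  qed
  then have "(\<Prod>j\<in>A. [:a j, b j:]) dvd G" using insert by auto
  moreover have "[:a k, b k:] = Polynomial.smult (b k) [:- r, 1:]"
    using bk by (simp add: r_def)
  then have "[:a k, b k:] dvd [:- r, 1:]"
    using bk by (metis dvd_refl smult_dvd_iff)
  ultimately show ?case
    using insert.hyps by (simp add: F mult_dvd_mono del: mult_pCons_left)
qed simp

lemma poly_eq_if_eq_off_0:
  fixes P Q :: "complex poly"
  assumes "\<And>t. t \<noteq> 0 \<Longrightarrow> poly P t = poly Q t"
  shows "P = Q"
proof -
  have "poly ([:0, 1:] * (P - Q)) t = 0" for t
    using assms[of t] by (cases "t = 0") auto
  then have "[:0, 1:] * (P - Q) = 0"
    using poly_all_0_iff_0 by blast
  then show ?thesis by simp
qed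

lemma P2_iff: "p \<in> P2 \<longleftrightarrow> (\<exists>u. u \<noteq> 0 \<and> p = vec.span {u})"
  by (auto simp: P2_def projectivization_def)

lemma vanishes_at_span:
  assumes "homogeneous m f"
  shows "vanishes_at f (vec.span {u}) \<longleftrightarrow> meval u f = 0"
proof -
  have "u \<in> vec.span {u}" by (simp add: vec.span_base)
  then show ?thesis
    by (auto simp: vanishes_at_def vec.span_singleton homogeneous_meval_scale[OF assms])
qed

section \<open>Sections of the divisor class of an arrangement\<close>

locale arrangement =
  fixes \<alpha> :: "'n::finite \<Rightarrow> 3 mpoly"
  assumes line_arrangement: "line_arrangement \<alpha>"
begin

abbreviation form :: "'n \<Rightarrow> complex ^ 3 \<Rightarrow> complex" where
  "form i u \<equiv> meval u (\<alpha> i)"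

lemma homogeneous_alpha: "homogeneous 1 (\<alpha> i)"
  using line_arrangement by (simp add: line_arrangement_def)

lemma linear_form: "linear_form (form i)"
  using homogeneous_1_imp_linear[OF homogeneous_alpha] by (simp add: linear_form_def)

lemmas form_simps = linear_formD[OF linear_form]

lemma along_alpha: "along u v (\<alpha> i) = [:form i u, form i v:]"
  by (rule iffD1[OF poly_eq_poly_eq_iff]) (auto simp: poly_along form_simps)

lemma meval_l_form: "meval u (l_form \<alpha> i) = (\<Prod>j\<in>UNIV - {i}. form j u)"
  by (simp add: l_form_def)

lemma along_l_form: "along u v (l_form \<alpha> i) = (\<Prod>j\<in>UNIV - {i}. [:form j u, form j v:])"
  by (simp add: l_form_def along_alpha)

lemma homogeneous_l_form: "homogeneous (CARD('n) - 1) (l_form \<alpha> i)"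
  using homogeneous_prod_linear[of "UNIV - {i}" \<alpha>] homogeneous_alpha
  by (simp add: l_form_def card_Diff_singleton)

lemma form_nonzero: "\<exists>u. form i u \<noteq> 0"
  using line_arrangement meval_eq_0_imp_eq_0[of "\<alpha> i"] by (auto simp: line_arrangement_def)

lemma form_not_proportional:
  assumes "i \<noteq> j"
  shows "\<exists>u. form i u \<noteq> c * form j u"
proof (rule ccontr)
  assume "\<not> ?thesis"
  then have "\<alpha> i - pscale c (\<alpha> j) = 0"
    by (intro meval_eq_0_imp_eq_0) simp
  then show False using line_arrangement assms by (auto simp: line_arrangement_def)
qed

text \<open>If \<open>\<alpha>\<^sub>j\<close> vanished on the kernel of \<open>\<alpha>\<^sub>i\<close>, it would be a multiple of \<open>\<alpha>\<^sub>i\<close>. The witness projects a vector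
  along \<open>w\<close> to that kernel.\<close>

lemma form_separates:
  assumes "i \<noteq> j"
  shows "\<exists>v. form i v = 0 \<and> form j v \<noteq> 0"
proof -
  obtain w where w: "form i w \<noteq> 0" using form_nonzero by blast
  obtain z where z: "form j z \<noteq> form j w / form i w * form i z"
    using form_not_proportional[of j i] assms by metis
  then show ?thesis
    using w by (intro exI[of _ "z - (form i z / form i w) *s w"]) (auto simp: form_simps field_simps)
qed

lemma generic_point: "\<exists>z. \<forall>i. form i z \<noteq> 0"
  using exists_avoiding[of UNIV UNIV form] linear_form form_nonzero by auto

lemma generic_point_on_line: "\<exists>v. form i v = 0 \<and> (\<forall>j. j \<noteq> i \<longrightarrow> form j v \<noteq> 0)"
  using exists_avoiding[of "{v \<in> UNIV. form i v = 0}" "UNIV - {i}" form]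
    subspace_kernel[OF vec.subspace_UNIV linear_form, of i] linear_form form_separates
  by auto

lemma lines_through_span: "lines_through \<alpha> (vec.span {u}) = {i. form i u = 0}"
  by (simp add: lines_through_def vanishes_at_span[OF homogeneous_alpha])

abbreviation sections :: "3 mpoly set" where
  "sections \<equiv> H0 (L2 \<alpha>) (D_arr \<alpha>)"

lemma l_form_in_sections: "l_form \<alpha> i \<in> sections"
proof -
  have "l_form \<alpha> i \<in> ideal_power poly_ring (vanishing_ideal {p}) (mu \<alpha> p)" if "p \<in> L2 \<alpha>" for p
  proof -
    let ?T = "lines_through \<alpha> p"
    have "mu \<alpha> p \<le> card (?T - {i})"
      by (simp add: mu_def card_Diff_singleton_if)
    then obtain K where K: "K \<subseteq> ?T - {i}" "card K = mu \<alpha> p"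
      by (metis obtain_subset_with_card_n)
    have "prod \<alpha> K \<in> ideal_power poly_ring (vanishing_ideal {p}) (card K)"
      using K homogeneous_alpha
      by (intro prod_in_ideal_power homogeneous_in_vanishing_ideal) (auto simp: lines_through_def)
    moreover have "ideal (ideal_power poly_ring (vanishing_ideal {p}) (mu \<alpha> p)) poly_ring"
      unfolding vanishing_ideal_def by (intro ideal_power_is_ideal genideal_poly_ring)
    moreover have "l_form \<alpha> i = prod \<alpha> (UNIV - {i} - K) * prod \<alpha> K"
      unfolding l_form_def using K by (intro prod.subset_diff) auto
    ultimately show ?thesis using K poly_idealD(3) by metis
  qed
  then show ?thesis using homogeneous_l_form by (simp add: H0_def D_arr_def)
qed

lemma sections_add: "f \<in> H0 Z D \<Longrightarrow> g \<in> H0 Z D \<Longrightarrow> f + g \<in> H0 Z D"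
  unfolding H0_def vanishing_ideal_def
  by (auto intro!: homogeneous_add poly_idealD(2) ideal_power_is_ideal genideal_poly_ring)

lemma sections_pscale: "f \<in> H0 Z D \<Longrightarrow> pscale c f \<in> H0 Z D"
  unfolding H0_def vanishing_ideal_def pscale_def
  by (auto intro!: homogeneous_pscale[unfolded pscale_def] poly_idealD(3) ideal_power_is_ideal
      genideal_poly_ring)

text \<open>The polynomials \<open>f(u + t v)\<close> and \<open>l\<^sub>i(u + t v)\<close> have degree at most \<open>d - 1\<close>, and with \<open>v\<close> on no other
  line the second one has degree exactly \<open>d - 1\<close>: none of its roots is at infinity. At each root,
  corresponding to a point \<open>p\<close>, its multiplicity is the number \<open>\<mu>(p)\<close> of other lines through \<open>p\<close>, to
  which order \<open>f\<close> vanishes too. So the two are proportional; comparing values at \<open>v\<close> shows that the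
  factor does not depend on \<open>u\<close>.\<close>

lemma section_on_line:
  assumes f: "f \<in> sections"
  shows "\<exists>c. \<forall>u. form i u = 0 \<longrightarrow> meval u f = c * meval u (l_form \<alpha> i)"
proof -
  let ?m = "CARD('n) - 1" and ?l = "l_form \<alpha> i"
  have hom: "homogeneous ?m f" using f by (simp add: H0_def D_arr_def)
  obtain v where v: "form i v = 0" "\<And>j. j \<noteq> i \<Longrightarrow> form j v \<noteq> 0"
    using generic_point_on_line by blast
  have lv: "meval v ?l \<noteq> 0" using v by (simp add: meval_l_form)
  have "meval u f = meval v f / meval v ?l * meval u ?l" if u: "form i u = 0" for u
  proof (cases "u \<in> vec.span {v}")
    case True
    then obtain s where "u = s *s v" by (auto simp: vec.span_singleton)
    then show ?thesis
      using lv by (simp add: homogeneous_meval_scale[OF hom] homogeneous_meval_scale[OF homogeneous_l_form])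
  next
    case False
    have "along u v ?l dvd along u v f"
      unfolding along_l_form
    proof (rule prod_linear_dvd)
      fix t
      define w where "w = u + t *s v"
      define T where "T = {j. form j w = 0}"
      have "w \<noteq> 0"
      proof
        assume "w = 0"
        then have "u = (- t) *s v" by (simp add: w_def eq_neg_iff_add_eq_0)
        then have "u \<in> vec.span {v}"
          by (simp only:) (intro vec.span_scale vec.span_base singletonI)
        then show False using False by simp
      qed
      have iT: "i \<in> T" using u v by (simp add: T_def w_def form_simps)
      have eq: "{j \<in> UNIV - {i}. form j u + t * form j v = 0} = T - {i}"
        by (auto simp: T_def w_def form_simps)
      have thr: "lines_through \<alpha> (vec.span {w}) = T" by (simp add: lines_through_span T_def)
      show "[:- t, 1:] ^ card {j \<in> UNIV - {i}. form j u + t * form j v = 0} dvd along u v f"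
      proof (cases "card T \<ge> 2")
        case True
        then have "vec.span {w} \<in> L2 \<alpha>"
          using \<open>w \<noteq> 0\<close> by (auto simp: L2_def P2_iff thr)
        then have "f \<in> ideal_power poly_ring (vanishing_ideal {vec.span {w}}) (mu \<alpha> (vec.span {w}))"
          using f by (simp add: H0_def D_arr_def)
        then have "[:- t, 1:] ^ mu \<alpha> (vec.span {w}) dvd along u v f"
          by (rule ideal_power_vanishing_order) (simp add: w_def vec.span_base)
        then show ?thesis
          using iT unfolding eq by (simp add: mu_def thr card_Diff_singleton)
      next
        case False
        then show ?thesis using iT unfolding eq by (simp add: card_Diff_singleton)
      qed
    qed (use v in auto)
    then obtain H where H: "along u v f = along u v ?l * H" by (auto elim: dvdE)
    have ne: "along u v ?l \<noteq> 0" using v by (simp add: along_l_form)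
    have deg: "Polynomial.degree (along u v ?l) = ?m"
    proof -
      have "Polynomial.degree (along u v ?l) = (\<Sum>j\<in>UNIV - {i}. Polynomial.degree [:form j u, form j v:])"
        unfolding along_l_form using v by (intro degree_prod_eq_sum_degree) auto
      also have "\<dots> = (\<Sum>j\<in>UNIV - {i}. 1)" using v by (intro sum.cong) auto
      finally show ?thesis by (simp add: card_Diff_singleton)
    qed
    have "Polynomial.degree H = 0"
    proof (cases "H = 0")
      case False
      then show ?thesis
        using degree_along_le[OF hom, of u v] degree_mult_eq[OF ne False]
        unfolding H deg by linarith
    qed simp
    then obtain c where "H = [:c:]" by (auto elim: degree_eq_zeroE)
    then have eq: "meval (u + t *s v) f = c * meval (u + t *s v) ?l" for t
      using arg_cong[OF H, of "\<lambda>P. poly P t"] by (simp add: poly_along)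
    \<comment> \<open>By homogeneity, \<open>v + s u\<close> may replace \<open>u + t v\<close> with \<open>t = 1 / s\<close>, which brings \<open>v\<close> to the parameter \<open>s = 0\<close>.\<close>
    have "along v u f = Polynomial.smult c (along v u ?l)"
    proof (rule poly_eq_if_eq_off_0)
      fix s :: complex assume "s \<noteq> 0"
      then have vu: "v + s *s u = s *s (u + (1 / s) *s v)"
        by (simp add: vec.scale_right_distrib add.commute)
      show "poly (along v u f) s = poly (Polynomial.smult c (along v u ?l)) s"
        unfolding poly_along poly_smult vu homogeneous_meval_scale[OF hom]
          homogeneous_meval_scale[OF homogeneous_l_form] eq by simp
    qed
    then have "poly (along v u f) 0 = c * poly (along v u ?l) 0" by simp
    then have "meval v f = c * meval v ?l" by (simp add: poly_along)
    then show ?thesis using eq[of 0] lv by simp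
  qed
  then show ?thesis by blast
qed

text \<open>A generic line through a point \<open>w\<close> off the arrangement meets the \<open>d\<close> lines in \<open>d\<close> distinct points,
  which is one zero too many for the degree.\<close>

lemma vanishing_on_lines_imp_0:
  assumes hom: "homogeneous (CARD('n) - 1) g" and van: "\<And>i u. form i u = 0 \<Longrightarrow> meval u g = 0"
  shows "g = 0"
proof (rule meval_eq_0_imp_eq_0)
  fix w
  show "meval w g = 0"
  proof (cases "\<exists>i. form i w = 0")
    case False
    \<comment> \<open>The index \<open>(i, i)\<close> asks that the line through \<open>w\<close> in direction \<open>v\<close> meets line \<open>i\<close> at a finite parameter,
      and \<open>(i, j)\<close> that it meets lines \<open>i\<close> and \<open>j\<close> at different ones.\<close>
    define b where "b = (\<lambda>(i, j) v. if i = j then form i v else form i w * form j v - form j w * form i v)"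
    have "linear_form (b k)" for k
      by (cases k) (auto simp: b_def linear_form_def form_simps algebra_simps)
    moreover have "\<exists>v. b k v \<noteq> 0" for k
    proof (cases k)
      case (Pair i j)
      show ?thesis
      proof (cases "i = j")
        case True
        then show ?thesis using Pair form_nonzero by (auto simp: b_def)
      next
        case ij: False
        then obtain v where "form i v = 0" "form j v \<noteq> 0" using form_separates by blast
        then show ?thesis using Pair False ij by (auto simp: b_def intro!: exI[of _ v])
      qed
    qed
    ultimately obtain v where v: "b k v \<noteq> 0" for k
      using exists_avoiding[of UNIV UNIV b] by auto
    have v1: "form i v \<noteq> 0" for i using v[of "(i, i)"] by (simp add: b_def)
    have v2: "form i w * form j v \<noteq> form j w * form i v" if "i \<noteq> j" for i j
      using v[of "(i, j)"] that by (simp add: b_def)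
    define t where "t i = - form i w / form i v" for i
    have "inj t"
    proof (rule injI)
      fix i j assume "t i = t j"
      then have "form i w * form j v = form j w * form i v"
        using v1[of i] v1[of j] by (simp add: t_def field_simps)
      then show "i = j" using v2 by blast
    qed
    have "along w v g = 0"
    proof (rule ccontr)
      assume ne: "along w v g \<noteq> 0"
      have "form i (w + t i *s v) = 0" for i
        using v1[of i] by (simp add: t_def form_simps)
      then have "range t \<subseteq> {x. poly (along w v g) x = 0}"
        using van by (auto simp: poly_along)
      then have "card (range t) \<le> card {x. poly (along w v g) x = 0}"
        by (intro card_mono poly_roots_finite ne)
      also have "\<dots> \<le> Polynomial.degree (along w v g)"
        using ne by (rule card_poly_roots_bound)
      also have "\<dots> \<le> CARD('n) - 1" using hom by (rule degree_along_le)
      finally show False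
        using card_image[OF \<open>inj t\<close>] zero_less_card_finite[where 'a = 'n] by linarith
    qed
    then have "poly (along w v g) 0 = 0" by simp
    then show ?thesis by (simp add: poly_along)
  qed (use van in blast)
qed

lemma l_form_on_other_line: "form i u = 0 \<Longrightarrow> j \<noteq> i \<Longrightarrow> meval u (l_form \<alpha> j) = 0"
  by (auto simp: meval_l_form)

theorem l_form_is_basis: "is_basis (l_form \<alpha>) sections"
proof -
  have inj: "inj (l_form \<alpha>)"
  proof (rule injI, rule ccontr)
    fix i j assume eq: "l_form \<alpha> i = l_form \<alpha> j" and "i \<noteq> j"
    obtain v where "form i v = 0" "\<And>k. k \<noteq> i \<Longrightarrow> form k v \<noteq> 0" using generic_point_on_line by blast
    then have "meval v (l_form \<alpha> i) \<noteq> 0" "meval v (l_form \<alpha> j) = 0"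
      using \<open>i \<noteq> j\<close> l_form_on_other_line by (auto simp: meval_l_form)
    then show False using eq by simp
  qed
  have "\<not> ps.dependent (range (l_form \<alpha>))"
  proof
    assume "ps.dependent (range (l_form \<alpha>))"
    then obtain c i where c: "c (l_form \<alpha> i) \<noteq> 0" "(\<Sum>l\<in>range (l_form \<alpha>). pscale (c l) l) = 0"
      by (auto simp: ps.dependent_finite)
    then have sum: "(\<Sum>j\<in>UNIV. pscale (c (l_form \<alpha> j)) (l_form \<alpha> j)) = 0"
      by (simp add: sum.reindex[OF inj])
    obtain v where v: "form i v = 0" "\<And>k. k \<noteq> i \<Longrightarrow> form k v \<noteq> 0" using generic_point_on_line by blast
    have "0 = (\<Sum>j\<in>UNIV. c (l_form \<alpha> j) * meval v (l_form \<alpha> j))"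
      using arg_cong[OF sum, of "meval v"] by simp
    also have "\<dots> = c (l_form \<alpha> i) * meval v (l_form \<alpha> i)"
      using l_form_on_other_line[OF v(1)] by (subst sum.remove[of _ i]) (auto intro!: sum.neutral)
    finally show False using c v by (auto simp: meval_l_form)
  qed
  moreover have "ps.span (range (l_form \<alpha>)) = sections"
  proof
    show "ps.span (range (l_form \<alpha>)) \<subseteq> sections"
    proof (rule ps.span_minimal)
      have "0 \<in> sections" using sections_pscale[OF l_form_in_sections, of 0] by (simp add: pscale_def)
      then show "ps.subspace sections"
        by (intro ps.subspaceI sections_add sections_pscale)
    qed (use l_form_in_sections in auto)
    show "sections \<subseteq> ps.span (range (l_form \<alpha>))"
    proof
      fix f assume f: "f \<in> sections"
      obtain c where c: "\<And>i u. form i u = 0 \<Longrightarrow> meval u f = c i * meval u (l_form \<alpha> i)"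
        using section_on_line[OF f] by metis
      define h where "h = (\<Sum>i\<in>UNIV. pscale (c i) (l_form \<alpha> i))"
      have "f + pscale (- 1) h = 0"
      proof (rule vanishing_on_lines_imp_0)
        show "homogeneous (CARD('n) - 1) (f + pscale (- 1) h)"
          unfolding h_def using f homogeneous_l_form
          by (intro homogeneous_add homogeneous_pscale homogeneous_sum) (auto simp: H0_def D_arr_def)
      next
        fix i u assume u: "form i u = 0"
        have "meval u h = c i * meval u (l_form \<alpha> i)"
          unfolding h_def using l_form_on_other_line[OF u]
          by (simp, subst sum.remove[of _ i]) (auto intro!: sum.neutral)
        then show "meval u (f + pscale (- 1) h) = 0" using c[OF u] by simp
      qed
      then have "f = h" by (simp add: ps.scale_minus_left)
      then show "f \<in> ps.span (range (l_form \<alpha>))"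
        by (simp only: h_def) (intro ps.span_sum ps.span_scale ps.span_base rangeI)
    qed
  qed
  ultimately show ?thesis using inj by (simp add: is_basis_def)
qed

end

section \<open>The values of the map on the blowup\<close>

interpretation fs: vector_space "fscale :: complex \<Rightarrow> ('a \<Rightarrow> complex) \<Rightarrow> _"
  by (rule vector_space_fscale)

lemma span_of_proportional:
  assumes "\<psi> \<in> S" "\<And>\<theta>. \<theta> \<in> S \<Longrightarrow> \<exists>c. \<theta> = fscale c \<psi>"
  shows "fs.span S = fs.span {\<psi>}"
proof
  show "fs.span S \<subseteq> fs.span {\<psi>}"
  proof (rule fs.span_minimal)
    show "S \<subseteq> fs.span {\<psi>}"
      using assms(2) by (auto simp: fs.span_singleton)
  qed (rule fs.subspace_span)
  show "fs.span {\<psi>} \<subseteq> fs.span S"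
    using assms(1) by (intro fs.span_mono) auto
qed

lemma tendsto_meval:
  fixes W :: "'t \<Rightarrow> complex ^ 'n::finite" and w :: "complex ^ 'n"
  assumes "\<And>i. ((\<lambda>t. W t $ i) \<longlongrightarrow> w $ i) net"
  shows "((\<lambda>t. meval (W t) F) \<longlongrightarrow> meval w F) net"
  by (induction F rule: mpoly_ring_induct) (auto intro!: tendsto_intros assms)

lemma homogeneous_OT_relation: "homogeneous (card J - 1) (OT_relation J c)"
  unfolding OT_relation_def
proof (intro homogeneous_sum homogeneous_pscale)
  fix j assume "j \<in> J"
  moreover have "homogeneous (card (J - {j})) (\<Prod>i\<in>J - {j}. Var i)"
    by (intro homogeneous_prod_linear homogeneous_Var) simp
  ultimately show "homogeneous (card J - 1) (\<Prod>i\<in>J - {j}. Var i)"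
    by (simp add: card_Diff_singleton)
qed

lemma prod_monom_1:
  fixes b :: "'i \<Rightarrow> complex"
  shows "finite S \<Longrightarrow> (\<Prod>j\<in>S. Polynomial.monom (b j) 1) = Polynomial.monom (\<Prod>j\<in>S. b j) (card S)"
  by (induction S rule: finite_induct) (auto simp: mult_monom)

lemma prod_without:
  fixes g :: "'n::finite \<Rightarrow> complex"
  assumes "g i \<noteq> 0"
  shows "prod g (UNIV - {i}) = prod g UNIV / g i"
  using assms by (simp add: prod.remove[of UNIV i g])

lemma subset_singleton_obtain:
  assumes "\<And>i j. i \<in> S \<Longrightarrow> j \<in> S \<Longrightarrow> i = j" "S \<subseteq> T" "T \<noteq> {}"
  obtains i where "S \<subseteq> {i}" "i \<in> T"
proof (cases "S = {}")
  case True
  then show thesis using assms(3) that by blast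
next
  case False
  then obtain i where "i \<in> S" by blast
  then show thesis using assms(1,2) by (intro that[of i]) auto
qed

context arrangement
begin

lemma span_l_form: "ps.span (range (l_form \<alpha>)) = sections"
  using l_form_is_basis by (simp add: is_basis_def)

lemma dual_eqI:
  assumes "\<theta> \<in> dual_space sections" "\<psi> \<in> dual_space sections"
    and "\<And>i. \<theta> (l_form \<alpha> i) = c * \<psi> (l_form \<alpha> i)"
  shows "\<theta> = fscale c \<psi>"
proof
  fix f
  let ?S = "{f \<in> sections. \<theta> f = c * \<psi> f}"
  have "0 \<in> sections" using sections_pscale[OF l_form_in_sections, of 0] by (simp add: pscale_def)
  moreover have "\<theta> (pscale 0 0) = 0 * \<theta> 0" "\<psi> (pscale 0 0) = 0 * \<psi> 0"
    using assms(1,2) \<open>0 \<in> sections\<close> unfolding dual_space_def by blast+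
  ultimately have "ps.subspace ?S"
    using assms(1,2)
    by (intro ps.subspaceI)
      (auto simp: dual_space_def sections_add sections_pscale algebra_simps)
  then have "ps.span (range (l_form \<alpha>)) \<subseteq> ?S"
    using assms(3) l_form_in_sections by (intro ps.span_minimal) auto
  then show "\<theta> f = fscale c \<psi> f"
    using assms(1,2) unfolding span_l_form by (cases "f \<in> sections") (auto simp: fscale_def dual_space_def)
qed

definition restrict_sections :: "(3 mpoly \<Rightarrow> complex) \<Rightarrow> 3 mpoly \<Rightarrow> complex" where
  "restrict_sections \<psi> = (\<lambda>f. if f \<in> sections then \<psi> f else 0)"

lemma restrict_sections_dual:
  assumes "\<And>f g. \<psi> (f + g) = \<psi> f + \<psi> g" "\<And>c f. \<psi> (pscale c f) = c * \<psi> f"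
  shows "restrict_sections \<psi> \<in> dual_space sections"
  using assms by (auto simp: restrict_sections_def dual_space_def sections_add sections_pscale)

lemma restrict_sections_l_form [simp]: "restrict_sections \<psi> (l_form \<alpha> i) = \<psi> (l_form \<alpha> i)"
  by (simp add: restrict_sections_def l_form_in_sections)

text \<open>Every point of the image is reached in this way: the curve \<open>p\<close> runs in the complement of the lines
  for small \<open>t \<noteq> 0\<close>, and \<open>W t\<close> is the vector of reciprocals at \<open>p t\<close>, rescaled so that it has a limit.\<close>

lemma OT_relation_vanishes_at_limit:
  fixes W :: "complex \<Rightarrow> complex ^ 'n" and w :: "complex ^ 'n"
  assumes "dependency \<alpha> J c"
    and "eventually (\<lambda>t. \<exists>s. s \<noteq> 0 \<and> (\<forall>i. form i (p t) \<noteq> 0 \<and> W t $ i = s / form i (p t))) (at (0::complex))"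
    and "\<And>i. ((\<lambda>t. W t $ i) \<longlongrightarrow> w $ i) (at 0)"
  shows "meval w (OT_relation J c) = 0"
proof -
  have "(\<Sum>j\<in>J. c j * form j u) = 0" for u
    using arg_cong[OF assms(1)[unfolded dependency_def], of "meval u"] by simp
  then have "eventually (\<lambda>t. meval (W t) (OT_relation J c) = 0) (at 0)"
    using assms(2) by (auto elim!: eventually_mono intro!: OT_relation_vanishes)
  then have "((\<lambda>t. meval (W t) (OT_relation J c)) \<longlongrightarrow> 0) (at 0)"
    by (rule tendsto_eventually)
  then show ?thesis
    using tendsto_unique[OF at_neq_bot tendsto_meval[of W w "at 0", OF assms(3)]] by blast
qed

lemma form_tendsto: "((\<lambda>t. form i (u + t *s v)) \<longlongrightarrow> form i u) (at 0)"
proof -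
  have "((\<lambda>t. form i u + t * form i v) \<longlongrightarrow> form i u + 0 * form i v) (at 0)"
    by (intro tendsto_intros)
  then show ?thesis by (simp add: form_simps)
qed

text \<open>At most one line passes through \<open>q\<close>, so some \<open>l\<^sub>i\<close> does not vanish there. For the relations, \<open>q\<close> is approached along any
  line leaving the arrangement.\<close>

lemma phi_off_exceptional_curves:
  assumes q: "q \<in> P2" "q \<notin> L2 \<alpha>"
  shows "\<exists>\<psi>\<in>dual_space sections. \<psi> \<noteq> 0 \<and> phi_arr \<alpha> (q, L) = fs.span {\<psi>} \<and>
    (\<forall>J c. dependency \<alpha> J c \<longrightarrow> meval (\<chi> i. \<psi> (l_form \<alpha> i)) (OT_relation J c) = 0)"
proof -
  obtain u where u: "u \<noteq> 0" "q = vec.span {u}" using q P2_iff by auto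
  define \<psi> where "\<psi> = restrict_sections (meval u)"
  have dual: "\<psi> \<in> dual_space sections" unfolding \<psi>_def by (rule restrict_sections_dual) auto
  have "card {i. form i u = 0} \<le> Suc 0"
    using q u by (auto simp: L2_def lines_through_span)
  then have "i = j" if "form i u = 0" "form j u = 0" for i j
    using that by (auto simp: card_le_Suc0_iff_eq)
  then obtain i where "{j. form j u = 0} \<subseteq> {i}"
    by (rule subset_singleton_obtain[of "{j. form j u = 0}" UNIV]) auto
  then have "\<psi> (l_form \<alpha> i) \<noteq> 0" by (auto simp: \<psi>_def meval_l_form)
  then have nz: "\<psi> \<noteq> 0" by auto
  have "section_values (L2 \<alpha>) (D_arr \<alpha>) (q, L) = {restrict_sections (meval u') | u'. u' \<in> q - {0}}"
    using q by (simp add: section_values_def restrict_sections_def)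
  moreover have "\<psi> \<in> {restrict_sections (meval u') | u'. u' \<in> q - {0}}"
    using u by (auto simp: \<psi>_def vec.span_base)
  moreover have "\<exists>c. \<theta> = fscale c \<psi>" if \<theta>: "\<theta> \<in> {restrict_sections (meval u') | u'. u' \<in> q - {0}}" for \<theta>
  proof -
    obtain a where "\<theta> = restrict_sections (meval (a *s u))"
      using \<theta> u by (auto simp: vec.span_singleton)
    then have "\<theta> = fscale (a ^ (CARD('n) - 1)) \<psi>"
      using dual unfolding \<psi>_def
      by (intro dual_eqI) (auto intro!: restrict_sections_dual simp: homogeneous_meval_scale[OF homogeneous_l_form])
    then show ?thesis by blast
  qed
  ultimately have span: "phi_arr \<alpha> (q, L) = fs.span {\<psi>}"
    unfolding phi_arr_def linear_system_map_def by (metis (no_types, lifting) span_of_proportional)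
  have "meval (\<chi> i. \<psi> (l_form \<alpha> i)) (OT_relation J c) = 0" if "dependency \<alpha> J c" for J c
  proof -
    obtain z where z: "\<And>i. form i z \<noteq> 0" using generic_point by blast
    show ?thesis
    proof (rule OT_relation_vanishes_at_limit[OF that,
          where p = "\<lambda>t. u + t *s z" and W = "\<lambda>t. \<chi> i. meval (u + t *s z) (l_form \<alpha> i)"])
      have "eventually (\<lambda>t. \<forall>i\<in>UNIV. form i (u + t *s z) \<noteq> 0) (at 0)"
        using z linear_form by (intro eventually_avoids) auto
      then show "eventually (\<lambda>t. \<exists>s. s \<noteq> 0 \<and> (\<forall>i. form i (u + t *s z) \<noteq> 0 \<and>
          (\<chi> i. meval (u + t *s z) (l_form \<alpha> i)) $ i = s / form i (u + t *s z))) (at 0)"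
      proof eventually_elim
        case (elim t)
        then show ?case
          by (intro exI[of _ "\<Prod>j\<in>UNIV. form j (u + t *s z)"])
            (auto simp: meval_l_form prod_without)
      qed
    next
      fix i
      show "((\<lambda>t. (\<chi> i. meval (u + t *s z) (l_form \<alpha> i)) $ i) \<longlongrightarrow> (\<chi> i. \<psi> (l_form \<alpha> i)) $ i) (at 0)"
        by (simp add: \<psi>_def meval_l_form) (intro tendsto_prod form_tendsto)
    qed
  qed
  then show ?thesis using dual nz span by blast
qed

text \<open>Two forms vanishing on the same plane in \<open>\<complex>\<^sup>3\<close> are proportional.\<close>

lemma two_lines_meet_once:
  assumes uv: "u \<noteq> 0" "v \<notin> vec.span {u}"
    and "form i u = 0" "form i v = 0" "form j u = 0" "form j v = 0"
  shows "i = j"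
proof (rule ccontr)
  assume "i \<noteq> j"
  then obtain w where w: "form i w = 0" "form j w \<noteq> 0" using form_separates by blast
  have ker: "vec.subspace {x \<in> UNIV. form k x = 0}" for k
    by (intro subspace_kernel vec.subspace_UNIV linear_form)
  have "vec.span {v, u} \<subseteq> {x \<in> UNIV. form j x = 0}"
    using assms by (intro vec.span_minimal ker) auto
  then have "w \<notin> vec.span {v, u}" using w by auto
  moreover have "v \<noteq> u" using uv vec.span_base[of u "{u}"] by auto
  moreover have "w \<notin> {v, u}" using calculation vec.span_base by blast
  ultimately have "vec.independent {w, v, u}" "card {w, v, u} = 3"
    using uv by (simp_all add: vec.independent_insert)
  then have "UNIV \<subseteq> vec.span {w, v, u}"
    by (intro vec.card_ge_dim_independent) (simp_all only: vec_dim_card, simp_all)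
  also have "\<dots> \<subseteq> {x \<in> UNIV. form i x = 0}"
    using assms w by (intro vec.span_minimal ker) auto
  finally show False using form_nonzero[of i] by auto
qed

lemma line_through_two_points:
  assumes "l \<in> lines_P2" "u \<in> l" "v \<in> l" "u \<noteq> 0" "v \<notin> vec.span {u}" "w \<in> l"
  obtains a b where "w = b *s v + a *s u"
proof -
  have "v \<noteq> u" using assms vec.span_base[of u "{u}"] by auto
  then have "vec.independent {v, u}" "card {v, u} = 2"
    using assms by (simp_all add: vec.independent_insert)
  then have "l \<subseteq> vec.span {v, u}"
    using assms by (intro vec.card_ge_dim_independent) (auto simp: lines_P2_def)
  then have "w \<in> vec.span {v, u}" using assms by auto
  then obtain b where "w - b *s v \<in> vec.span {u}" by (auto simp: vec.span_breakdown_eq)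
  then obtain a where "w - b *s v = a *s u" by (auto simp: vec.span_singleton)
  then have "w = b *s v + a *s u" by (simp add: algebra_simps)
  then show thesis by (rule that)
qed

text \<open>With \<open>k + 1\<close> lines through the point, each of their forms contributes a factor \<open>t\<close>. If line \<open>i\<close> is
  among them, \<open>l\<^sub>i\<close> has exactly \<open>k\<close> such factors; otherwise it has \<open>k + 1\<close>, and the coefficient of \<open>t ^ k\<close> is
  \<open>0\<close>.\<close>

lemma coeff_along_l_form:
  assumes "T = {j. form j u = 0}" "T \<noteq> {}"
  shows "Polynomial.coeff (along u v (l_form \<alpha> i)) (card T - 1) =
    (if i \<in> T then \<Prod>j\<in>UNIV - {i}. if j \<in> T then form j v else form j u else 0)"
proof -
  let ?K = "T - {i}" and ?N = "- T - {i}"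
  have un: "UNIV - {i} = ?K \<union> ?N" and disj: "?K \<inter> ?N = {}" by auto
  define Q where "Q = (\<Prod>j\<in>?N. [:form j u, form j v:])"
  have "(\<Prod>j\<in>?K. [:form j u, form j v:]) = (\<Prod>j\<in>?K. Polynomial.monom (form j v) 1)"
    using assms(1) by (intro prod.cong) (auto simp: monom_altdef)
  also have "\<dots> = Polynomial.monom (\<Prod>j\<in>?K. form j v) (card ?K)"
    by (rule prod_monom_1) simp
  finally have "along u v (l_form \<alpha> i) = Polynomial.monom (\<Prod>j\<in>?K. form j v) (card ?K) * Q"
    unfolding along_l_form un Q_def using disj by (subst prod.union_disjoint) auto
  then have coeff: "Polynomial.coeff (along u v (l_form \<alpha> i)) (card T - 1) =
      (if card T - 1 < card ?K then 0 else (\<Prod>j\<in>?K. form j v) * Polynomial.coeff Q (card T - 1 - card ?K))"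
    by (simp add: coeff_monom_mult)
  show ?thesis
  proof (cases "i \<in> T")
    case False
    then have "?K = T" by auto
    moreover have "card T > 0" using assms(2) by (simp add: card_gt_0_iff)
    ultimately show ?thesis unfolding coeff using False by simp
  next
    case True
    have "Polynomial.coeff Q 0 = (\<Prod>j\<in>?N. form j u)"
      by (simp add: Q_def poly_prod flip: poly_0_coeff_0)
    moreover have "(\<Prod>j\<in>UNIV - {i}. if j \<in> T then form j v else form j u) =
        (\<Prod>j\<in>?K. if j \<in> T then form j v else form j u) * (\<Prod>j\<in>?N. if j \<in> T then form j v else form j u)"
      unfolding un using disj by (intro prod.union_disjoint) auto
    moreover have "card ?K = card T - 1" using True by (simp add: card_Diff_singleton)
    ultimately show ?thesis unfolding coeff using True by simp
  qed
qed

text \<open>The line \<open>L q\<close> is the line of at most one form through \<open>q\<close>. If it is line \<open>i\<close>, take that \<open>l\<^sub>i\<close>, otherwise any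
  \<open>l\<^sub>i\<close> with line \<open>i\<close> through \<open>q\<close>: its value is not \<open>0\<close>. Another choice \<open>a u\<close>, \<open>b v + c u\<close> of coordinates multiplies
  all the values of \<open>coeff_along_l_form\<close> by the same constant.\<close>

lemma phi_on_exceptional_curve:
  assumes q: "q \<in> L2 \<alpha>" and l: "L q \<in> lines_P2" "q \<subseteq> L q"
  shows "\<exists>\<psi>\<in>dual_space sections. \<psi> \<noteq> 0 \<and> phi_arr \<alpha> (q, L) = fs.span {\<psi>} \<and>
    (\<forall>J c. dependency \<alpha> J c \<longrightarrow> meval (\<chi> i. \<psi> (l_form \<alpha> i)) (OT_relation J c) = 0)"
proof -
  have "q \<in> P2" using q by (simp add: L2_def)
  then obtain u where u: "u \<noteq> 0" "q = vec.span {u}" using P2_iff by auto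
  then have "u \<in> L q" using l vec.span_base by blast
  have "\<not> L q \<subseteq> q"
  proof
    assume "L q \<subseteq> q"
    then have "vec.dim (L q) \<le> card {u}"
      unfolding u by (intro vec.dim_le_card) auto
    then show False using l by (simp add: lines_P2_def)
  qed
  then obtain v where v: "v \<in> L q" "v \<notin> vec.span {u}" using u by auto
  define T where "T = {j. form j u = 0}"
  define k where "k = card T - 1"
  have thr: "lines_through \<alpha> q = T" by (simp add: u lines_through_span T_def)
  then have order: "snd (D_arr \<alpha>) q = k" by (simp add: D_arr_def mu_def k_def)
  have "card T \<ge> 2" using q thr by (simp add: L2_def)
  then have T: "T \<noteq> {}" by auto
  define ev where "ev u v = restrict_sections (\<lambda>f. Polynomial.coeff (along u v f) k)" for u v
  define \<psi> where "\<psi> = ev u v"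
  have dual: "ev u v \<in> dual_space sections" for u v
    unfolding ev_def by (rule restrict_sections_dual) auto
  have \<psi>: "\<psi> (l_form \<alpha> i) = (if i \<in> T then \<Prod>j\<in>UNIV - {i}. if j \<in> T then form j v else form j u else 0)" for i
    using coeff_along_l_form[OF T_def T] by (simp add: \<psi>_def ev_def k_def)
  have "i = j" if "i \<in> {j \<in> T. form j v = 0}" "j \<in> {j \<in> T. form j v = 0}" for i j
    using that two_lines_meet_once[OF u(1) v(2), of i j] by (auto simp: T_def)
  then obtain i where "{j \<in> T. form j v = 0} \<subseteq> {i}" "i \<in> T"
    by (rule subset_singleton_obtain[of "{j \<in> T. form j v = 0}" T]) (use T in auto)
  then have "\<psi> (l_form \<alpha> i) \<noteq> 0" by (auto simp: \<psi> T_def)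
  then have nz: "\<psi> \<noteq> 0" by auto
  have "section_values (L2 \<alpha>) (D_arr \<alpha>) (q, L) = {ev u v | u v. u \<in> q - {0} \<and> v \<in> L q - q}"
    unfolding ev_def restrict_sections_def order[symmetric] using q by (simp add: section_values_def)
  moreover have "\<psi> \<in> {ev u v | u v. u \<in> q - {0} \<and> v \<in> L q - q}"
    using u v vec.span_base[of u "{u}"] by (auto simp: \<psi>_def)
  moreover have "\<exists>c. \<theta> = fscale c \<psi>" if \<theta>: "\<theta> \<in> {ev u v | u v. u \<in> q - {0} \<and> v \<in> L q - q}" for \<theta>
  proof -
    obtain u' v' where uv': "\<theta> = ev u' v'" "u' \<in> q - {0}" "v' \<in> L q" using \<theta> by blast
    obtain a where a: "u' = a *s u" "a \<noteq> 0"
      using uv' u by (auto simp: vec.span_singleton)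
    obtain b c where b: "v' = b *s v + c *s u"
      using line_through_two_points[OF l(1) \<open>u \<in> L q\<close> v(1) u(1) v(2) uv'(3)] by blast
    have T': "T = {j. form j u' = 0}" using a by (simp add: T_def form_simps)
    have scale: "(\<Prod>j\<in>UNIV - {i}. if j \<in> T then form j v' else form j u') =
        b ^ k * a ^ card (- T) * (\<Prod>j\<in>UNIV - {i}. if j \<in> T then form j v else form j u)" if i: "i \<in> T" for i
    proof -
      have "(\<Prod>j\<in>UNIV - {i}. if j \<in> T then form j v' else form j u') =
          (\<Prod>j\<in>UNIV - {i}. (if j \<in> T then b else a) * (if j \<in> T then form j v else form j u))"
        by (intro prod.cong) (auto simp: a b form_simps T_def)
      also have "\<dots> = (\<Prod>j\<in>UNIV - {i}. if j \<in> T then b else a) * (\<Prod>j\<in>UNIV - {i}. if j \<in> T then form j v else form j u)"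
        by (rule prod.distrib)
      also have "(\<Prod>j\<in>UNIV - {i}. if j \<in> T then b else a) = b ^ k * a ^ card (- T)"
      proof -
        have "UNIV - {i} = (T - {i}) \<union> - T" "(T - {i}) \<inter> - T = {}" using i by auto
        then have "(\<Prod>j\<in>UNIV - {i}. if j \<in> T then b else a) =
            (\<Prod>j\<in>T - {i}. if j \<in> T then b else a) * (\<Prod>j\<in>- T. if j \<in> T then b else a)"
          by (simp only: prod.union_disjoint finite)
        then show ?thesis using i by (simp add: k_def card_Diff_singleton)
      qed
      finally show ?thesis .
    qed
    have "ev u' v' = fscale (b ^ k * a ^ card (- T)) \<psi>"
    proof (rule dual_eqI[OF dual])
      show "\<psi> \<in> dual_space sections" unfolding \<psi>_def by (rule dual)
      show "ev u' v' (l_form \<alpha> i) = b ^ k * a ^ card (- T) * \<psi> (l_form \<alpha> i)" for i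
        using coeff_along_l_form[OF T' T, of v' i] scale[of i] by (simp add: ev_def \<psi> k_def)
    qed
    then show ?thesis using uv' by blast
  qed
  ultimately have span: "phi_arr \<alpha> (q, L) = fs.span {\<psi>}"
    unfolding phi_arr_def linear_system_map_def by (metis (no_types, lifting) span_of_proportional)
  have "meval (\<chi> i. \<psi> (l_form \<alpha> i)) (OT_relation J c) = 0" if "dependency \<alpha> J c" for J c
  proof -
    obtain z where z: "\<And>i. form i z \<noteq> 0" using generic_point by blast
    \<comment> \<open>The line \<open>L q\<close> may belong to the arrangement, so the second-order term \<open>t\<^sup>2 z\<close> is needed to leave
      it; \<open>A j t\<close> is the form \<open>j\<close> on the curve with its forced factor \<open>t\<close> removed.\<close>
    define p where "p t = u + t *s (v + t *s z)" for t
    define A where "A j t = (if j \<in> T then form j (v + t *s z) else form j u + t * form j (v + t *s z))" for j t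
    have form_p: "form j (p t) = (if j \<in> T then t else 1) * A j t" for j t
      unfolding p_def A_def form_simps(2)[where u = u] by (simp add: T_def)
    have A_lim: "(A j \<longlongrightarrow> (if j \<in> T then form j v else form j u)) (at 0)" for j
    proof -
      have "((\<lambda>t. form j u + t * form j (v + t *s z)) \<longlongrightarrow> form j u + 0 * form j v) (at 0)"
        by (intro tendsto_intros form_tendsto)
      then show ?thesis
        using form_tendsto by (cases "j \<in> T") (simp_all add: A_def[abs_def])
    qed
    have A_ne: "eventually (\<lambda>t. A j t \<noteq> 0) (at 0)" for j
    proof (cases "j \<in> T")
      case True
      have "eventually (\<lambda>t. \<forall>i\<in>UNIV. form i (v + t *s z) \<noteq> 0) (at 0)"
        using z linear_form by (intro eventually_avoids) auto
      then show ?thesis by eventually_elim (simp add: A_def True)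
    next
      case False
      then show ?thesis
        using A_lim[of j] by (intro tendsto_imp_eventually_ne) (auto simp: T_def)
    qed
    show ?thesis
    proof (rule OT_relation_vanishes_at_limit[OF that, where p = p
          and W = "\<lambda>t. \<chi> i. (if i \<in> T then 1 else t) * (\<Prod>j\<in>UNIV - {i}. A j t)"])
      have "eventually (\<lambda>t. \<forall>j\<in>UNIV. A j t \<noteq> 0) (at 0)"
        by (intro eventually_ball_finite ballI A_ne finite)
      then show "eventually (\<lambda>t. \<exists>s. s \<noteq> 0 \<and> (\<forall>i. form i (p t) \<noteq> 0 \<and>
          (\<chi> i. (if i \<in> T then 1 else t) * (\<Prod>j\<in>UNIV - {i}. A j t)) $ i = s / form i (p t))) (at 0)"
        using eventually_neq_at_within[of 0 0 UNIV]
      proof eventually_elim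
        case (elim t)
        then show ?case
          by (intro exI[of _ "t * (\<Prod>j\<in>UNIV. A j t)"])
            (auto simp: form_p prod_without)
      qed
    next
      fix i
      have "((\<lambda>t. (if i \<in> T then 1 else t) * (\<Prod>j\<in>UNIV - {i}. A j t)) \<longlongrightarrow>
          (if i \<in> T then 1 else 0) * (\<Prod>j\<in>UNIV - {i}. if j \<in> T then form j v else form j u)) (at 0)"
        by (intro tendsto_mult tendsto_prod A_lim) (auto intro: tendsto_ident_at)
      then show "((\<lambda>t. (\<chi> i. (if i \<in> T then 1 else t) * (\<Prod>j\<in>UNIV - {i}. A j t)) $ i) \<longlongrightarrow> (\<chi> i. \<psi> (l_form \<alpha> i)) $ i) (at 0)"
        by (simp add: \<psi> if_distrib if_distribR cong: if_cong)
    qed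
  qed
  then show ?thesis using dual[of u v] nz span by (auto simp: \<psi>_def)
qed

lemma phi_on_blowup:
  assumes "x \<in> blowup (L2 \<alpha>)"
  shows "\<exists>\<psi>\<in>dual_space sections. \<psi> \<noteq> 0 \<and> phi_arr \<alpha> x = fs.span {\<psi>} \<and>
    (\<forall>J c. dependency \<alpha> J c \<longrightarrow> meval (\<chi> i. \<psi> (l_form \<alpha> i)) (OT_relation J c) = 0)"
proof -
  obtain q L where x: "x = (q, L)" by (cases x)
  show ?thesis
  proof (cases "q \<in> L2 \<alpha>")
    case True
    then show ?thesis unfolding x
      using assms by (intro phi_on_exceptional_curve) (auto simp: x blowup_def PiE_mem)
  next
    case False
    then show ?thesis unfolding x
      using assms by (intro phi_off_exceptional_curves) (auto simp: x blowup_def)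
  qed
qed

end

section \<open>The ideal of the image\<close>

context arrangement
begin

abbreviation phi_image :: "(complex ^ 'n) set set" where
  "phi_image \<equiv> dual_coords (l_form \<alpha>) ` phi_arr \<alpha> ` blowup (L2 \<alpha>)"

text \<open>By \<open>phi_on_blowup\<close> a relation vanishes at one vector of each line in the image, and by
  homogeneity at all of them.\<close>

lemma OT_ideal_subset: "OT_ideal \<alpha> \<subseteq> vanishing_ideal phi_image"
  unfolding OT_ideal_def
proof (rule genideal_poly_ring(3))
  show "ideal (vanishing_ideal phi_image) poly_ring"
    unfolding vanishing_ideal_def by (rule genideal_poly_ring)
  show "{OT_relation J c | J c. dependency \<alpha> J c} \<subseteq> vanishing_ideal phi_image"
  proof safe
    fix J c assume dep: "dependency \<alpha> J c"
    show "OT_relation J c \<in> vanishing_ideal phi_image"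
    proof (rule homogeneous_in_vanishing_ideal[OF homogeneous_OT_relation])
      fix W assume "W \<in> phi_image"
      then obtain x where x: "x \<in> blowup (L2 \<alpha>)" "W = dual_coords (l_form \<alpha>) (phi_arr \<alpha> x)"
        by auto
      obtain \<psi> where \<psi>: "phi_arr \<alpha> x = fs.span {\<psi>}"
        "meval (\<chi> i. \<psi> (l_form \<alpha> i)) (OT_relation J c) = 0"
        using phi_on_blowup[OF x(1)] dep by blast
      show "vanishes_at (OT_relation J c) W"
        unfolding vanishes_at_def
      proof
        fix w assume "w \<in> W"
        then obtain a where "w = (\<chi> i. fscale a \<psi> (l_form \<alpha> i))"
          by (auto simp: x \<psi> dual_coords_def fs.span_singleton)
        then have "w = a *s (\<chi> i. \<psi> (l_form \<alpha> i))"
          by (simp add: vec_eq_iff fscale_def)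
        then show "meval w (OT_relation J c) = 0"
          by (simp add: homogeneous_meval_scale[OF homogeneous_OT_relation] \<psi>)
      qed
    qed
  qed
qed

text \<open>Off the centre of the blowup, the lines \<open>L p\<close> are those joining \<open>p\<close> to the given point.\<close>

lemma generic_point_in_blowup:
  assumes u: "\<And>i. form i u \<noteq> 0"
  shows "\<exists>L. (vec.span {u}, L) \<in> blowup (L2 \<alpha>)" "vec.span {u} \<notin> L2 \<alpha>"
proof -
  have u0: "u \<noteq> 0" using u form_simps(4) by auto
  show "vec.span {u} \<notin> L2 \<alpha>" using u by (simp add: L2_def lines_through_span)
  define L where "L = (\<lambda>p\<in>L2 \<alpha>. vec.span (insert u p))"
  have "vec.span (insert u p) \<in> lines_P2" if p: "p \<in> L2 \<alpha>" for p
  proof -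
    from p obtain w where w: "w \<noteq> 0" "p = vec.span {w}" by (auto simp: L2_def P2_iff)
    have "lines_through \<alpha> p \<noteq> {}" using p by (auto simp: L2_def)
    then obtain i where "form i w = 0" by (auto simp: w lines_through_span)
    have "u \<notin> vec.span {w}"
    proof
      assume "u \<in> vec.span {w}"
      then obtain a where "u = a *s w" by (auto simp: vec.span_singleton)
      then show False using u[of i] \<open>form i w = 0\<close> by (simp add: form_simps)
    qed
    moreover from this have "u \<noteq> w" using vec.span_base[of w "{w}"] by auto
    ultimately have "vec.independent {u, w}" "card {u, w} = 2"
      using w by (simp_all add: vec.independent_insert)
    then have "vec.dim (vec.span {u, w}) = 2"
      by (simp add: vec.dim_eq_card_independent)
    moreover have "vec.span (insert u p) = vec.span {u, w}"
      unfolding w by (auto simp: vec.span_breakdown_eq vec.span_span)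
    ultimately show ?thesis by (simp add: lines_P2_def vec.subspace_span)
  qed
  then have "(vec.span {u}, L) \<in> blowup (L2 \<alpha>)"
    using u0 by (auto simp: blowup_def P2_iff L_def vec.span_base intro: vec.span_mono[THEN subsetD])
  then show "\<exists>L. (vec.span {u}, L) \<in> blowup (L2 \<alpha>)" by blast
qed

lemma OT_on_subset_OT_ideal: "OT_on UNIV form UNIV \<subseteq> OT_ideal \<alpha>"
proof
  have ideal: "ideal (OT_ideal \<alpha>) poly_ring"
    unfolding OT_ideal_def by (rule genideal_poly_ring)
  fix f assume "f \<in> OT_on UNIV form UNIV"
  then show "f \<in> OT_ideal \<alpha>"
  proof (induction rule: OT_on.induct)
    case zero
    show ?case by (rule poly_idealD(1)[OF ideal])
  next
    case (step x g J c)
    have "dependency \<alpha> J c"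
      unfolding dependency_def using step by (intro meval_eq_0_imp_eq_0) simp
    then have "OT_relation J c \<in> OT_ideal \<alpha>"
      unfolding OT_ideal_def by (intro subsetD[OF genideal_poly_ring(2)]) blast
    then show ?case using step by (intro poly_idealD[OF ideal])
  qed
qed

text \<open>At a point off the arrangement the reciprocals differ from the coordinates of the image
  point by a scalar, and \<open>F\<close> is homogeneous.\<close>

lemma vanishing_ideal_subset: "vanishing_ideal phi_image \<subseteq> OT_ideal \<alpha>"
  unfolding vanishing_ideal_def
proof (rule genideal_poly_ring(3))
  show "ideal (OT_ideal \<alpha>) poly_ring"
    unfolding OT_ideal_def by (rule genideal_poly_ring)
  show "{f. (\<exists>m. homogeneous m f) \<and> (\<forall>p\<in>phi_image. vanishes_at f p)} \<subseteq> OT_ideal \<alpha>"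
  proof safe
    fix F m assume hom: "homogeneous m F" and van: "\<forall>W\<in>phi_image. vanishes_at F W"
    have "meval (reciprocals form u) F = 0" if u: "\<forall>i\<in>UNIV. form i u \<noteq> 0" for u
    proof -
      obtain L where L: "(vec.span {u}, L) \<in> blowup (L2 \<alpha>)" and off: "vec.span {u} \<notin> L2 \<alpha>"
        using generic_point_in_blowup u by blast
      have "u \<noteq> 0" using u form_simps(4) by auto
      then have "restrict_sections (meval u) \<in> section_values (L2 \<alpha>) (D_arr \<alpha>) (vec.span {u}, L)"
        using off vec.span_base[of u "{u}"]
        by (auto simp: section_values_def restrict_sections_def)
      then have "restrict_sections (meval u) \<in> phi_arr \<alpha> (vec.span {u}, L)"
        unfolding phi_arr_def linear_system_map_def by (rule fs.span_base)
      then have "(\<chi> i. meval u (l_form \<alpha> i)) \<in> dual_coords (l_form \<alpha>) (phi_arr \<alpha> (vec.span {u}, L))"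
        unfolding dual_coords_def by (intro rev_image_eqI[of "restrict_sections (meval u)"]) auto
      then have "meval (\<chi> i. meval u (l_form \<alpha> i)) F = 0"
        using van L by (auto simp: vanishes_at_def)
      moreover have "reciprocals form u = (1 / (\<Prod>j\<in>UNIV. form j u)) *s (\<chi> i. meval u (l_form \<alpha> i))"
        using u by (simp add: vec_eq_iff reciprocals_def meval_l_form prod_without)
      ultimately show ?thesis by (simp add: homogeneous_meval_scale[OF hom])
    qed
    then have "F \<in> OT_on UNIV form UNIV"
      using linear_form form_nonzero
      by (intro vanishing_at_reciprocals_imp_OT_on polys_in_UNIV) auto
    then show "F \<in> OT_ideal \<alpha>" using OT_on_subset_OT_ideal by blast
  qed
qed

lemma phi_in_projectivization:
  "phi_arr \<alpha> \<in> blowup (L2 \<alpha>) \<rightarrow> projectivization fscale (dual_space sections)"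
  using phi_on_blowup by (fastforce simp: projectivization_def)

end

theorem mainTheorem1:
  fixes \<alpha> :: "'n::finite \<Rightarrow> 3 mpoly"
  assumes "line_arrangement \<alpha>"
  shows "is_basis (l_form \<alpha>) (H0 (L2 \<alpha>) (D_arr \<alpha>)) \<and>
    phi_arr \<alpha> \<in> blowup (L2 \<alpha>) \<rightarrow>
      projectivization fscale (dual_space (H0 (L2 \<alpha>) (D_arr \<alpha>))) \<and>
    OT_algebra \<alpha> =
      homogeneous_coordinate_ring (dual_coords (l_form \<alpha>) ` phi_arr \<alpha> ` blowup (L2 \<alpha>))"
proof -
  interpret arrangement \<alpha> using assms by unfold_locales
  have "OT_ideal \<alpha> = vanishing_ideal phi_image"
    using OT_ideal_subset vanishing_ideal_subset by (rule subset_antisym)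
  then show ?thesis
    using l_form_is_basis phi_in_projectivization
    by (simp add: OT_algebra_def homogeneous_coordinate_ring_def)
qed

end
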